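(* Let $k\in\mathbb{N}$ and let $p_1,\dots,p_k\in\mathbb{R}[x]$. Then the following are equivalent: (1) The set $\{1,p_1,\dots,p_k\}$ is linearly independent over $\mathbb{R}$. (2) For every choice of scattered sequences $a_1,\dots,a_k:\mathbb{N}\to\mathbb{R}$, for Lebesgue-almost every $x\in\mathbb{R}$ the sequence $\big(a_1(n)p_1(x),\dots,a_k(n)p_k(x)\big)_{n\in\mathbb{N}}$ is uniformly distributed in $\mathbb{T}^k$.
   Context: $\mathbb{N}=\{1,2,\dots\}$, $\mathbb{T}^k=\mathbb{R}^k/\mathbb{Z}^k$. A sequence $(x_n)_{n\in\mathbb{N}}$ in $\mathbb{R}^k$ is uniformly distributed in $\mathbb{T}^k$ (equivalently, uniformly distributed modulo 1) if for all intervals $I_1,\dots,I_k\subset[0,1]$, $\lim_{N\to\infty}\frac1N|\{n\in\{1,\dots,N\}:\{x_n\}\in I_1\times\cdots\times I_k\}|=\mu(I_1\times\cdots\times I_k)$, where $\mu$ is $k$-dimensional Lebesgue measure and $\{y\}$ is the vector of coordinatewise fractional parts of $y\in\mathbb{R}^k$. For $\delta\in(0,1]$, a sequence $a:\mathbb{N}\to\mathbb{R}$ is $\delta$-scattered if there exists $\epsilon>0$ such that for every sufficiently large $N$, $\frac1{N^2}\sum_{1\le m<n\le N}\min\big(|a(n)-a(m)|^{-\delta},1\big)\le\frac1{(\log N)^{1+\epsilon}}$ (with the term equal to $1$ when $a(n)=a(m)$). The sequence $a$ is scattered if it is $\delta$-scattered for every $\delta\in(0,1]$. Linear independence of $\{1,p_1,\dots,p_k\}$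 is meant for the family (no nontrivial real linear combination of $1,p_1,\dots,p_k$ vanishes identically). *)

theory Defs
  imports "HOL-Analysis.Analysis" "HOL-Computational_Algebra.Polynomial"
begin

text \<open>
  Sequences are indexed by the positive integers. They are represented by functions on
  \<^typ>\<open>nat\<close> whose value at \<open>0\<close> is never used. The dimension \<open>k \<ge> 1\<close> is the
  cardinality of a finite index type.
\<close>

text \<open>Intervals of every kind (open, closed, half-open, degenerate) are admitted.\<close>

definition unif_dist_mod1 :: "(nat \<Rightarrow> real ^ 'k) \<Rightarrow> bool" where
  "unif_dist_mod1 x \<longleftrightarrow>
     (\<forall>I :: 'k \<Rightarrow> real set. (\<forall>i. is_interval (I i) \<and> I i \<subseteq> {0..1}) \<longrightarrow>
        (\<lambda>N. real (card {n \<in> {1..N}. (\<chi> i. frac (x n $ i)) \<in> {y. \<forall>i. y $ i \<in> I i}}) / real N)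
          \<longlonglongrightarrow> measure lebesgue {y :: real ^ 'k. \<forall>i. y $ i \<in> I i})"

text \<open>
  The case distinction is needed because \<open>0 powr (- \<delta>) = 0\<close> in Isabelle/HOL, whereas the
  term for \<open>a n = a m\<close> has to be \<open>1\<close>.
\<close>

definition delta_scattered :: "real \<Rightarrow> (nat \<Rightarrow> real) \<Rightarrow> bool" where
  "delta_scattered \<delta> a \<longleftrightarrow>
     (\<exists>\<epsilon>>0. \<forall>\<^sub>F N in sequentially.
        1 / (real N)\<^sup>2 *
          (\<Sum>(m, n) \<in> {(m, n). 1 \<le> m \<and> m < n \<and> n \<le> N}.
             if a n = a m then 1 else min (\<bar>a n - a m\<bar> powr (- \<delta>)) 1)
        \<le> 1 / (ln (real N)) powr (1 + \<epsilon>))"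

definition scattered :: "(nat \<Rightarrow> real) \<Rightarrow> bool" where
  "scattered a \<longleftrightarrow> (\<forall>\<delta>. 0 < \<delta> \<and> \<delta> \<le> 1 \<longrightarrow> delta_scattered \<delta> a)"

text \<open>
  Linear independence over the reals of the family consisting of the constant polynomial
  \<open>1\<close> and all \<open>p i\<close>. Being about the family and not its set of values, it fails if
  two members coincide.
\<close>

definition lin_indep_with_one :: "('k::finite \<Rightarrow> real poly) \<Rightarrow> bool" where
  "lin_indep_with_one p \<longleftrightarrow>
     (\<forall>(c0 :: real) (c :: 'k \<Rightarrow> real).
        smult c0 1 + (\<Sum>i\<in>UNIV. smult (c i) (p i)) = 0 \<longrightarrow> c0 = 0 \<and> (\<forall>i. c i = 0))"

end

theory Submission
  imports Defs "HOL-Real_Asymp.Real_Asymp"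
begin

text \<open>
  By Weyl's criterion, linear independence implies equidistribution once the exponential averages
  with phases \<open>\<Sum>i. h i * a i n * p i x\<close>, \<open>h \<noteq> 0\<close>, tend to \<open>0\<close> for almost every \<open>x\<close>. The second
  moment of such an average over a bounded interval is a mean over pairs \<open>(m, n)\<close> of oscillatory
  integrals. Linear independence of \<open>1\<close> and the \<open>p i\<close> makes the derivative of the phase
  comparable to its coefficient vector outside a small sublevel set, so each integral is at most
  a negative power of \<open>\<bar>a i n - a i m\<bar>\<close>, and scatteredness bounds the mean by
  \<open>(ln N) powr - (1 + \<epsilon>)\<close>. This is summable along a sequence with ratios tending to \<open>1\<close>, which
  gives convergence almost everywhere.

  Conversely, a dependency with coefficients \<open>c i\<close> and the scattered sequences \<open>c i * 2 ^ n\<close>, suitably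
  scaled, keep the points inside a proper closed subgroup of the torus.
\<close>

subsection \<open>Oscillatory integrals of polynomial phases\<close>

text \<open>The hypothesis speaks of each sequence alone, while the phases mix all differences
  \<open>a i n - a i m\<close>, whose relative sizes are unknown. The way out is a decay bound in
  terms of the norm of the whole coefficient vector: it dominates every entry, so a single index
  \<open>j\<close> with \<open>h j \<noteq> 0\<close> suffices and the other sequences cannot spoil
  the estimate. Such a bound must be uniform over all coefficient vectors; therefore the sublevel
  estimate has a constant that depends only on the degree bound and the interval. The price is a
  decay exponent of order one over the degree bound, which scatteredness for arbitrarily small
  \<open>\<delta>\<close> pays for.

  In the passage from a subsequence to all \<open>N\<close>, one more summand changes a partial sum
  by at most \<open>1\<close>, so gaps of relative size tending to \<open>0\<close> are harmless.

  In the converse, powers of \<open>2\<close> are chosen because they are integers: after division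
  by the constant coefficient, multiplying the dependency by \<open>2 ^ n\<close> keeps its constant
  term integral for every \<open>n\<close> and every \<open>x\<close>.\<close>

text \<open>A Remez-type inequality, by induction on the degree: dividing by \<open>x - x0\<close>
  with \<open>x0\<close> in \<open>E\<close> gives a quotient that is still small on the part of
  \<open>E\<close> away from \<open>x0\<close>, and that part keeps half of the measure. A lower
  bound \<open>m\<close> in place of the measure itself makes the halving convenient.\<close>

lemma poly_sublevel_coeff_bound:
  fixes R :: real
  assumes R: "R \<ge> 0"
  shows "\<exists>C\<ge>0. \<forall>q E \<nu> m. degree q \<le> d \<longrightarrow> E \<in> lmeasurable \<longrightarrow> E \<subseteq> {-R..R} \<longrightarrow>
           (\<forall>x\<in>E. \<bar>poly q x\<bar> \<le> \<nu>) \<longrightarrow> 0 < m \<longrightarrow> m \<le> measure lebesgue E \<longrightarrow>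
           (\<Sum>i\<le>d. \<bar>coeff q i\<bar>) * m ^ d \<le> C * \<nu>"
proof (induction d)
  case 0
  show ?case
  proof (intro exI[of _ 1] conjI allI impI)
    fix q :: "real poly" and E :: "real set" and \<nu> m :: real
    assume a: "degree q \<le> 0" "\<forall>x\<in>E. \<bar>poly q x\<bar> \<le> \<nu>" "0 < m" "m \<le> measure lebesgue E"
    then have "E \<noteq> {}" by auto
    then obtain x where "x \<in> E" by blast
    moreover obtain c where "q = [:c:]"
      using a(1) by (metis degree_0_id le_0_eq)
    ultimately show "(\<Sum>i\<le>0. \<bar>coeff q i\<bar>) * m ^ 0 \<le> 1 * \<nu>"
      using a(2) by force
  qed simp
next
  case (Suc d)
  then obtain C where C: "C \<ge> 0" and IH: "\<And>q E \<nu> m. degree q \<le> d \<Longrightarrow> E \<in> lmeasurable \<Longrightarrow>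
      E \<subseteq> {-R..R} \<Longrightarrow> (\<And>x. x \<in> E \<Longrightarrow> \<bar>poly q x\<bar> \<le> \<nu>) \<Longrightarrow> 0 < m \<Longrightarrow> m \<le> measure lebesgue E \<Longrightarrow>
      (\<Sum>i\<le>d. \<bar>coeff q i\<bar>) * m ^ d \<le> C * \<nu>"
    by metis
  \<comment> \<open>The first summand absorbs the value at \<open>x0\<close> by means of
    \<open>m \<le> 2 * R\<close>. In the second, \<open>2 ^ d\<close> comes from halving
    \<open>m\<close>, \<open>8\<close> from dividing a variation of \<open>2 * \<nu>\<close> by the
    distance \<open>m / 4\<close>, and \<open>1 + R\<close> from multiplying back by
    \<open>x - x0\<close>.\<close>
  define C' where "C' = (2 * R) ^ Suc d + (1 + R) * (2 ^ d * 8 * C)"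
  show ?case
  proof (intro exI[of _ C'] conjI allI impI)
    show "C' \<ge> 0" using C R by (auto simp: C'_def)
    fix q :: "real poly" and E :: "real set" and \<nu> m :: real
    assume deg: "degree q \<le> Suc d" and E: "E \<in> lmeasurable" "E \<subseteq> {-R..R}"
      and nu: "\<forall>x\<in>E. \<bar>poly q x\<bar> \<le> \<nu>" and m: "0 < m" "m \<le> measure lebesgue E"
    from m have "E \<noteq> {}" by auto
    then obtain x0 where x0: "x0 \<in> E" by blast
    have nu0: "\<nu> \<ge> 0" using nu x0 by force
    define r where "r = synthetic_div q x0"
    have q: "q = pCons (poly q x0) r - smult x0 r"
      using synthetic_div_correct[of q x0] by (simp add: r_def algebra_simps)
    have degr: "degree r \<le> d" using deg by (simp add: r_def degree_synthetic_div)
    define E' where "E' = E - {x0 - m/4..x0 + m/4}"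
    have E': "E' \<in> lmeasurable" unfolding E'_def by (intro fmeasurable_Diff E) auto
    have "measure lebesgue E \<le> measure lebesgue (E' \<union> {x0 - m/4..x0 + m/4})"
      by (intro measure_mono_fmeasurable fmeasurable.Un E') (use E in \<open>auto simp: E'_def\<close>)
    also have "\<dots> \<le> measure lebesgue E' + measure lebesgue {x0 - m/4..x0 + m/4}"
      by (intro measure_Un_le) (use E' in auto)
    also have "\<dots> = measure lebesgue E' + m / 2" using m by simp
    finally have mE': "m / 2 \<le> measure lebesgue E'" using m by simp
    have bd: "\<bar>poly r x\<bar> \<le> 8 * \<nu> / m" if x: "x \<in> E'" for x
    proof -
      have "poly q x = poly q x0 + (x - x0) * poly r x"
        by (subst q) (simp add: algebra_simps)
      then have "\<bar>x - x0\<bar> * \<bar>poly r x\<bar> = \<bar>poly q x - poly q x0\<bar>"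
        by (simp add: abs_mult)
      also have "\<dots> \<le> 2 * \<nu>"
        using nu x0 x unfolding E'_def by (smt (verit) DiffD1)
      finally have "\<bar>x - x0\<bar> * \<bar>poly r x\<bar> \<le> 2 * \<nu>" .
      moreover have "m / 4 \<le> \<bar>x - x0\<bar>" using x by (auto simp: E'_def abs_if)
      ultimately have "m / 4 * \<bar>poly r x\<bar> \<le> 2 * \<nu>"
        by (meson abs_ge_zero mult_right_mono order_trans)
      then show ?thesis using m by (simp add: field_simps)
    qed
    have "(\<Sum>i\<le>d. \<bar>coeff r i\<bar>) * (m / 2) ^ d \<le> C * (8 * \<nu> / m)"
      using IH[OF degr E' _ bd _ mE'] E m by (auto simp: E'_def)
    then have r1: "(\<Sum>i\<le>d. \<bar>coeff r i\<bar>) * m ^ Suc d \<le> 2 ^ d * 8 * C * \<nu>"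
      using m by (simp add: field_simps)
    have m2: "m \<le> 2 * R"
    proof -
      have "measure lebesgue E \<le> measure lebesgue {-R..R}"
        by (intro measure_mono_fmeasurable) (use E in auto)
      then show ?thesis using m R by simp
    qed
    have cr: "coeff r (Suc d) = 0" using degr by (simp add: coeff_eq_0)
    have "(\<Sum>i\<le>Suc d. \<bar>coeff q i\<bar>) \<le> (\<Sum>i\<le>Suc d. \<bar>coeff (pCons (poly q x0) r) i\<bar> + \<bar>x0\<bar> * \<bar>coeff r i\<bar>)"
      by (intro sum_mono, subst q) (simp add: abs_mult[symmetric])
    also have "\<dots> = \<bar>poly q x0\<bar> + (\<Sum>i\<le>d. \<bar>coeff r i\<bar>) + \<bar>x0\<bar> * (\<Sum>i\<le>d. \<bar>coeff r i\<bar>)"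
      by (subst sum.distrib, subst sum.atMost_Suc_shift) (simp add: cr sum_distrib_left)
    also have "\<dots> \<le> \<nu> + (1 + R) * (\<Sum>i\<le>d. \<bar>coeff r i\<bar>)"
    proof -
      have "\<bar>x0\<bar> * (\<Sum>i\<le>d. \<bar>coeff r i\<bar>) \<le> R * (\<Sum>i\<le>d. \<bar>coeff r i\<bar>)"
        by (intro mult_right_mono sum_nonneg) (use x0 E in \<open>auto simp: abs_le_iff subset_iff\<close>)
      then show ?thesis using nu x0 by (auto simp: algebra_simps)
    qed
    finally have "(\<Sum>i\<le>Suc d. \<bar>coeff q i\<bar>) * m ^ Suc d
        \<le> (\<nu> + (1 + R) * (\<Sum>i\<le>d. \<bar>coeff r i\<bar>)) * m ^ Suc d"
      by (intro mult_right_mono) (use m in auto)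
    also have "\<dots> = \<nu> * m ^ Suc d + (1 + R) * ((\<Sum>i\<le>d. \<bar>coeff r i\<bar>) * m ^ Suc d)"
      by (simp only: algebra_simps)
    also have "\<dots> \<le> \<nu> * (2 * R) ^ Suc d + (1 + R) * (2 ^ d * 8 * C * \<nu>)"
      by (intro add_mono mult_left_mono r1 power_mono) (use m m2 R nu0 in auto)
    also have "\<dots> = C' * \<nu>" by (simp add: C'_def algebra_simps)
    finally show "(\<Sum>i\<le>Suc d. \<bar>coeff q i\<bar>) * m ^ Suc d \<le> C' * \<nu>" .
  qed
qed

text \<open>
  The amplitude \<open>1 = Q\<^sup>2 / (Q\<^sup>2 + \<mu>\<^sup>2) + \<mu>\<^sup>2 / (Q\<^sup>2 + \<mu>\<^sup>2)\<close> with \<open>Q = P'\<close> is split so that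
  the first part can be integrated by parts although \<open>Q\<close> may vanish.
\<close>

lemma norm_integral_cis_poly_le:
  fixes P :: "real poly" and u v \<mu> D :: real
  defines "Q \<equiv> poly (pderiv P)"
  assumes uv: "u \<le> v" and mu: "\<mu> > 0"
    and D: "\<And>x. x \<in> {u..v} \<Longrightarrow> \<bar>poly (pderiv (pderiv P)) x\<bar> \<le> D"
  shows "norm (integral {u..v} (\<lambda>x. cis (poly P x)))
           \<le> integral {u..v} (\<lambda>x. \<mu>\<^sup>2 / ((Q x)\<^sup>2 + \<mu>\<^sup>2)) + 1 / \<mu> + (v - u) * D / \<mu>\<^sup>2"
proof -
  define Q' where "Q' = poly (pderiv (pderiv P))"
  \<comment> \<open>Since \<open>Q * cis P\<close> is the derivative of \<open>cis P\<close> up to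
    the factor \<open>\<i>\<close>, the amplitude \<open>Q * g\<close> is the one to integrate by
    parts. Unlike \<open>1 / Q\<close>, the quotient \<open>g\<close> stays bounded at the zeros of
    \<open>Q\<close>.\<close>
  define g where "g = (\<lambda>x. Q x / ((Q x)\<^sup>2 + \<mu>\<^sup>2))"
  define g' where "g' = (\<lambda>x. Q' x * (\<mu>\<^sup>2 - (Q x)\<^sup>2) / ((Q x)\<^sup>2 + \<mu>\<^sup>2)\<^sup>2)"
  have pos: "(Q x)\<^sup>2 + \<mu>\<^sup>2 > 0" for x using mu by (simp add: add_nonneg_pos)
  have contQ: "continuous_on S Q" "continuous_on S Q'" for S
    unfolding Q_def Q'_def by (intro continuous_intros)+
  have ne: "(Q x)\<^sup>2 + \<mu>\<^sup>2 \<noteq> 0" for x using pos[of x] by linarith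
  have contg: "continuous_on S g" "continuous_on S g'" for S
    unfolding g_def g'_def using ne by (auto intro!: continuous_intros contQ)
  have contK: "continuous_on S (\<lambda>x. \<mu>\<^sup>2 / ((Q x)\<^sup>2 + \<mu>\<^sup>2))" for S
    using ne by (intro continuous_intros contQ) auto
  have contcis: "continuous_on S (\<lambda>x. cis (poly P x))" for S
    by (intro continuous_intros)
  have dQ: "(Q has_real_derivative Q' x) (at x within S)" for x S
    unfolding Q_def Q'_def using poly_DERIV DERIV_subset by blast
  have dP: "((poly P) has_real_derivative Q x) (at x within S)" for x S
    unfolding Q_def using poly_DERIV DERIV_subset by blast
  have dg: "(g has_real_derivative g' x) (at x within S)" for x S
    unfolding g_def g'_def
    by (rule derivative_eq_intros dQ refl ne)+ (simp add: power2_eq_square algebra_simps)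
  have "((\<lambda>x. cis (poly P x) * of_real (g x)) has_vector_derivative
          (\<i> * of_real (Q x) * cis (poly P x)) * of_real (g x) + cis (poly P x) * of_real (g' x))
          (at x within S)" for x S
  proof -
    have "((\<lambda>x. cis (poly P x)) has_vector_derivative \<i> * of_real (Q x) * cis (poly P x)) (at x within S)"
      unfolding has_vector_derivative_def
      by (rule has_derivative_eq_rhs[OF has_derivative_cis[OF dP[unfolded has_field_derivative_def]]])
         (auto simp: scaleR_conv_of_real)
    from has_vector_derivative_mult[OF this has_vector_derivative_of_real[OF dg]] show ?thesis
      by (simp add: add.commute)
  qed
  then have "((\<lambda>x. (\<i> * of_real (Q x) * cis (poly P x)) * of_real (g x) + cis (poly P x) * of_real (g' x))
      has_integral (cis (poly P v) * of_real (g v) - cis (poly P u) * of_real (g u))) {u..v}"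
    by (intro fundamental_theorem_of_calculus uv) auto
  then have I0: "integral {u..v} (\<lambda>x. (\<i> * of_real (Q x) * cis (poly P x)) * of_real (g x) + cis (poly P x) * of_real (g' x))
     = cis (poly P v) * of_real (g v) - cis (poly P u) * of_real (g u)"
    by (rule integral_unique)
  define A where "A = integral {u..v} (\<lambda>x. cis (poly P x) * of_real (Q x * g x))"
  define B where "B = integral {u..v} (\<lambda>x. cis (poly P x) * of_real (g' x))"
  define K where "K = integral {u..v} (\<lambda>x. cis (poly P x) * of_real (\<mu>\<^sup>2 / ((Q x)\<^sup>2 + \<mu>\<^sup>2)))"
  have int: "(\<lambda>x. cis (poly P x) * of_real (Q x * g x)) integrable_on {u..v}"
     "(\<lambda>x. cis (poly P x) * of_real (g' x)) integrable_on {u..v}"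
     "(\<lambda>x. cis (poly P x) * of_real (\<mu>\<^sup>2 / ((Q x)\<^sup>2 + \<mu>\<^sup>2))) integrable_on {u..v}"
     "(\<lambda>x. \<mu>\<^sup>2 / ((Q x)\<^sup>2 + \<mu>\<^sup>2)) integrable_on {u..v}"
    by (rule integrable_continuous_real, intro continuous_on_mult contcis continuous_on_of_real contg contQ contK)+
  have "\<i> * A + B = cis (poly P v) * of_real (g v) - cis (poly P u) * of_real (g u)"
    unfolding A_def B_def I0[symmetric]
    by (subst integral_mult_right[symmetric], subst Henstock_Kurzweil_Integration.integral_add[symmetric])
       (use int in \<open>auto intro!: integral_cong integrable_on_mult_right simp: algebra_simps\<close>)
  then have "A = - \<i> * (cis (poly P v) * of_real (g v) - cis (poly P u) * of_real (g u) - B)"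
    by (simp add: algebra_simps complex_eq_iff)
  then have "norm A = norm (cis (poly P v) * of_real (g v) - cis (poly P u) * of_real (g u) - B)"
    by (simp add: norm_mult)
  also have "\<dots> \<le> norm (cis (poly P v) * of_real (g v)) + norm (cis (poly P u) * of_real (g u)) + norm B"
    by (meson add_right_mono norm_triangle_ineq4 order_trans)
  also have "\<dots> = \<bar>g v\<bar> + \<bar>g u\<bar> + norm B" by (simp add: norm_mult)
  finally have A: "norm A \<le> \<bar>g v\<bar> + \<bar>g u\<bar> + norm B" .
  \<comment> \<open>The inequality of arithmetic and geometric means; the two endpoints together
    give the term \<open>1 / \<mu>\<close>.\<close>
  have gb: "\<bar>g x\<bar> \<le> 1 / (2 * \<mu>)" for x
  proof -
    have "0 \<le> (\<bar>Q x\<bar> - \<mu>)\<^sup>2" by simp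
    then have "\<bar>Q x\<bar> * (2 * \<mu>) \<le> (Q x)\<^sup>2 + \<mu>\<^sup>2" by (simp add: power2_diff algebra_simps)
    then show ?thesis using mu pos[of x] by (simp add: g_def abs_divide field_simps)
  qed
  have g'b: "\<bar>g' x\<bar> \<le> D / \<mu>\<^sup>2" if "x \<in> {u..v}" for x
  proof -
    have "\<bar>g' x\<bar> = \<bar>Q' x\<bar> * \<bar>\<mu>\<^sup>2 - (Q x)\<^sup>2\<bar> / ((Q x)\<^sup>2 + \<mu>\<^sup>2)\<^sup>2"
      by (simp add: g'_def abs_mult abs_divide)
    also have "\<dots> \<le> D * ((Q x)\<^sup>2 + \<mu>\<^sup>2) / ((Q x)\<^sup>2 + \<mu>\<^sup>2)\<^sup>2"
      by (intro divide_right_mono mult_mono) (use D[OF that] in \<open>auto simp: Q'_def abs_le_iff\<close>)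
    also have "\<dots> = D / ((Q x)\<^sup>2 + \<mu>\<^sup>2)" using ne by (simp add: power2_eq_square)
    also have "\<dots> \<le> D / \<mu>\<^sup>2"
      by (intro divide_left_mono) (use D[OF that] mu pos in auto)
    finally show ?thesis .
  qed
  have "norm B \<le> integral {u..v} (\<lambda>x. D / \<mu>\<^sup>2)"
    unfolding B_def by (rule integral_norm_bound_integral) (use int g'b in \<open>auto simp: norm_mult\<close>)
  then have B: "norm B \<le> (v - u) * D / \<mu>\<^sup>2" using uv by simp
  have K: "norm K \<le> integral {u..v} (\<lambda>x. \<mu>\<^sup>2 / ((Q x)\<^sup>2 + \<mu>\<^sup>2))"
    unfolding K_def
  proof (rule integral_norm_bound_integral[OF int(3,4)])
    fix x
    show "norm (cis (poly P x) * of_real (\<mu>\<^sup>2 / ((Q x)\<^sup>2 + \<mu>\<^sup>2))) \<le> \<mu>\<^sup>2 / ((Q x)\<^sup>2 + \<mu>\<^sup>2)"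
      using pos[of x] by (simp only: norm_mult norm_cis norm_of_real) simp
  qed
  have "integral {u..v} (\<lambda>x. cis (poly P x)) = A + K"
  proof -
    have "cis (poly P x) = cis (poly P x) * of_real (Q x * g x) + cis (poly P x) * of_real (\<mu>\<^sup>2 / ((Q x)\<^sup>2 + \<mu>\<^sup>2))" for x
    proof -
      have "Q x * g x + \<mu>\<^sup>2 / ((Q x)\<^sup>2 + \<mu>\<^sup>2) = 1"
        using ne[of x] by (simp add: g_def add_divide_distrib[symmetric] power2_eq_square)
      then show ?thesis by (metis distrib_left mult.right_neutral of_real_1 of_real_add)
    qed
    then show ?thesis unfolding A_def K_def
      by (subst Henstock_Kurzweil_Integration.integral_add[symmetric]) (use int in auto)
  qed
  then have "norm (integral {u..v} (\<lambda>x. cis (poly P x))) \<le> norm A + norm K"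
    by (simp add: norm_triangle_ineq)
  moreover have "1 / (2 * \<mu>) + 1 / (2 * \<mu>) = 1 / \<mu>" by simp
  ultimately show ?thesis using A B K gb[of u] gb[of v] by linarith
qed


section \<open>Uniform decay for linear combinations of independent polynomials\<close>

lemma pderiv_sum: "pderiv (\<Sum>i\<in>A. f i) = (\<Sum>i\<in>A. pderiv (f i))"
  by (induction A rule: infinite_finite_induct) (auto simp: pderiv_add)

text \<open>This is where the member \<open>1\<close> of the family enters: a combination whose
  derivative vanishes is constant, and a constant cancels against a multiple of
  \<open>1\<close>.\<close>

lemma lin_indep_with_oneD:
  fixes p :: "'k::finite \<Rightarrow> real poly"
  assumes "lin_indep_with_one p" "(\<Sum>i\<in>UNIV. smult (b i) (pderiv (p i))) = 0"
  shows "b i = 0"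
proof -
  have "pderiv (\<Sum>i\<in>UNIV. smult (b i) (p i)) = 0"
    using assms(2) by (simp add: pderiv_sum pderiv_smult)
  then obtain c where "(\<Sum>i\<in>UNIV. smult (b i) (p i)) = [:c:]"
    by (metis pderiv_iszero)
  then have "smult (-c) 1 + (\<Sum>i\<in>UNIV. smult (b i) (p i)) = 0"
    by (simp add: one_pCons)
  then show ?thesis using assms(1) unfolding lin_indep_with_one_def by blast
qed

text \<open>The argument uses the norm \<open>B\<close> of the whole vector \<open>b\<close> and
  passes to the single entry \<open>b i\<close> only at the very end. \<open>C\<close> and
  \<open>\<delta>\<close> are chosen before \<open>b\<close>, and \<open>\<delta> \<le> 1\<close>
  keeps the exponent in the range over which \<open>scattered\<close> quantifies.\<close>

lemma norm_integral_cis_lin_comb_le: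
  fixes p :: "'k::finite \<Rightarrow> real poly"
  assumes indep: "lin_indep_with_one p" and R: "R \<ge> 0"
  shows "\<exists>C \<delta>. C \<ge> 0 \<and> 0 < \<delta> \<and> \<delta> \<le> 1 \<and> (\<forall>b i. \<bar>b i\<bar> \<ge> 1 \<longrightarrow>
           norm (integral {-R..R} (\<lambda>x. cis (\<Sum>i\<in>UNIV. b i * poly (p i) x))) \<le> C * \<bar>b i\<bar> powr - \<delta>)"
proof -
  define q where "q b = (\<Sum>i\<in>UNIV. smult (b $ i) (pderiv (p i)))" for b :: "real ^ 'k"
  \<comment> \<open>A common degree bound for all phase derivatives; \<open>Suc\<close> ensures
    \<open>d \<ge> 1\<close>, so that \<open>d\<close>-th roots make sense.\<close>
  define d where "d = Suc (\<Sum>i\<in>UNIV. degree (pderiv (p i)))"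
  have degq: "degree (q b) \<le> d" for b
    unfolding q_def
  proof (intro degree_sum_le)
    fix i
    have "degree (smult (b $ i) (pderiv (p i))) \<le> degree (pderiv (p i))"
      by (rule degree_smult_le)
    also have "\<dots> \<le> (\<Sum>i\<in>UNIV. degree (pderiv (p i)))"
      by (rule member_le_sum) auto
    finally show "degree (smult (b $ i) (pderiv (p i))) \<le> d" by (simp add: d_def)
  qed auto
  define F where "F b = (\<Sum>j\<le>d. \<bar>coeff (q b) j\<bar>)" for b
  have coeffq: "coeff (q b) j = (\<Sum>i\<in>UNIV. b $ i * coeff (pderiv (p i)) j)" for b j
    by (simp add: q_def coeff_sum)
  have F_scale: "F (t *\<^sub>R b) = \<bar>t\<bar> * F b" for t b
  proof -
    have "coeff (q (t *\<^sub>R b)) j = t * coeff (q b) j" for j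
      unfolding coeffq by (simp add: sum_distrib_left mult.assoc)
    then show ?thesis by (simp add: F_def abs_mult sum_distrib_left)
  qed
  \<comment> \<open>By independence \<open>F\<close> vanishes only at \<open>0\<close>. It is
    continuous and absolutely homogeneous, so its minimum over the compact unit sphere is positive
    and serves as \<open>c\<close>.\<close>
  obtain c where c: "c > 0" "\<And>b. F b \<ge> c * norm b"
  proof -
    have "compact (sphere 0 1 :: (real ^ 'k) set)" by simp
    moreover have "axis undefined 1 \<in> (sphere 0 1 :: (real ^ 'k) set)" by (simp add: norm_axis_1)
    moreover have "continuous_on (sphere 0 1) F"
      unfolding F_def coeffq by (intro continuous_intros)
    ultimately obtain b0 where b0: "b0 \<in> sphere 0 1" "\<And>b. b \<in> sphere 0 1 \<Longrightarrow> F b0 \<le> F b"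
      using continuous_attains_inf[of "sphere 0 1" F] by blast
    have "F b0 \<noteq> 0"
    proof
      assume "F b0 = 0"
      then have z: "\<forall>j\<le>d. coeff (q b0) j = 0" by (simp add: F_def sum_nonneg_eq_0_iff)
      have "coeff (q b0) j = 0" for j
        using z degq[of b0] by (cases "j \<le> d") (auto intro: coeff_eq_0)
      then have "q b0 = 0" by (simp add: poly_eq_iff)
      then have "b0 $ i = 0" for i
        using lin_indep_with_oneD[OF indep, of "($) b0" i] by (simp add: q_def)
      then have "b0 = 0" by (simp add: vec_eq_iff)
      then show False using b0 by simp
    qed
    moreover have "F b0 \<ge> 0" by (simp add: F_def sum_nonneg)
    ultimately have pos: "F b0 > 0" by linarith
    have "F b \<ge> F b0 * norm b" for b
    proof (cases "b = 0")
      case False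
      have "F b = norm b * F ((1 / norm b) *\<^sub>R b)"
        using False by (subst F_scale) simp
      also have "\<dots> \<ge> norm b * F b0"
        using False by (intro mult_left_mono b0(2)) auto
      finally show ?thesis by (simp add: mult.commute)
    qed (simp add: F_def sum_nonneg)
    then show thesis using pos that by blast
  qed
  obtain M where M: "M \<ge> 0" "\<And>b x. x \<in> {-R..R} \<Longrightarrow> \<bar>poly (pderiv (q b)) x\<bar> \<le> M * norm b"
  proof -
    have "\<exists>M. \<forall>x\<in>{-R..R}. \<bar>poly (pderiv (pderiv (p i))) x\<bar> \<le> M" for i
    proof -
      have "compact ((\<lambda>x. poly (pderiv (pderiv (p i))) x) ` {-R..R})"
        by (intro compact_continuous_image continuous_intros) auto
      then show ?thesis by (auto dest!: compact_imp_bounded simp: bounded_iff)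
    qed
    then obtain m where m: "\<And>i x. x \<in> {-R..R} \<Longrightarrow> \<bar>poly (pderiv (pderiv (p i))) x\<bar> \<le> m i"
      by metis
    have m0: "m i \<ge> 0" for i using m[of 0 i] R by auto
    have "\<bar>poly (pderiv (q b)) x\<bar> \<le> (\<Sum>i\<in>UNIV. m i) * norm b" if "x \<in> {-R..R}" for b x
    proof -
      have "\<bar>poly (pderiv (q b)) x\<bar> = \<bar>\<Sum>i\<in>UNIV. b $ i * poly (pderiv (pderiv (p i))) x\<bar>"
        by (simp add: q_def pderiv_sum pderiv_smult poly_sum)
      also have "\<dots> \<le> (\<Sum>i\<in>UNIV. \<bar>b $ i * poly (pderiv (pderiv (p i))) x\<bar>)"
        by (rule sum_abs)
      also have "\<dots> \<le> (\<Sum>i\<in>UNIV. norm b * m i)"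
        unfolding abs_mult by (intro sum_mono mult_mono m that component_le_norm_cart) auto
      finally show ?thesis by (simp add: sum_distrib_left mult.commute)
    qed
    then show thesis using m0 that[of "\<Sum>i\<in>UNIV. m i"] by (simp add: sum_nonneg)
  qed
  from poly_sublevel_coeff_bound[OF R, of d] obtain C0 where C0: "C0 \<ge> 0"
    and sub: "\<And>q E \<nu> m. degree q \<le> d \<Longrightarrow> E \<in> lmeasurable \<Longrightarrow> E \<subseteq> {-R..R} \<Longrightarrow>
           (\<And>x. x \<in> E \<Longrightarrow> \<bar>poly q x\<bar> \<le> \<nu>) \<Longrightarrow> 0 < m \<Longrightarrow> m \<le> measure lebesgue E \<Longrightarrow>
           (\<Sum>i\<le>d. \<bar>coeff q i\<bar>) * m ^ d \<le> C0 * \<nu>"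
    by metis
  \<comment> \<open>At height \<open>B powr (7/8)\<close>, against coefficients of size at least
    \<open>c * B\<close>, the sublevel set has measure of order at most
    \<open>(B powr (-1/8)) powr (1 / d)\<close>. This is the slowest decay among all error
    terms.\<close>
  define \<delta> where "\<delta> = 1 / (8 * real d)"
  have "d \<ge> 1" by (simp add: d_def)
  then have d1: "real d \<ge> 1" by linarith
  then have \<delta>: "0 < \<delta>" "\<delta> \<le> 1 / 8" by (auto simp: \<delta>_def field_simps)
  define K where "K = (C0 / c) powr (1 / real d)"
  \<comment> \<open>In order: the sublevel set, the kernel off that set, the boundary terms, and the
    term with the second derivative of the phase.\<close>
  define C where "C = K + 2 * R + 1 + 2 * R * M"
  have C: "C \<ge> 0" using R M by (simp add: C_def K_def)
  have "norm (integral {-R..R} (\<lambda>x. cis (\<Sum>i\<in>UNIV. b i * poly (p i) x))) \<le> C * \<bar>b i\<bar> powr - \<delta>"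
    if bi: "\<bar>b i\<bar> \<ge> 1" for b i
  proof -
    define v where "v = (\<chi> i. b i)"
    define B where "B = norm v"
    have Bb: "\<bar>b i\<bar> \<le> B"
      using component_le_norm_cart[of v i] by (simp add: B_def v_def)
    with bi have B1: "B \<ge> 1" by linarith
    define P where "P = (\<Sum>i\<in>UNIV. smult (b i) (p i))"
    have P': "pderiv P = q v" by (simp add: P_def q_def v_def pderiv_sum pderiv_smult)
    \<comment> \<open>The exponents \<open>3/4\<close> and \<open>7/8\<close> satisfy three demands:
      \<open>\<mu>\<^sup>2\<close> beats the second derivative, which is of size at most
      \<open>M * B\<close>; \<open>\<nu>\<close> beats \<open>\<mu>\<close>, so that the kernel is
      small off \<open>E\<close>; and \<open>\<nu>\<close> is small against \<open>B\<close>, so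
      that \<open>E\<close> is small.\<close>
    define \<mu> where "\<mu> = B powr (3/4)"
    define \<nu> where "\<nu> = B powr (7/8)"
    have mu: "\<mu> > 0" "\<nu> > 0" using B1 by (auto simp: \<mu>_def \<nu>_def)
    define E where "E = {x \<in> {-R..R}. \<bar>poly (q v) x\<bar> \<le> \<nu>}"
    have E: "E \<in> lmeasurable"
    proof (rule lmeasurable_compact)
      have "E = {-R..R} \<inter> {x. \<bar>poly (q v) x\<bar> \<le> \<nu>}" by (auto simp: E_def)
      then have "closed E" by (auto intro!: closed_Int closed_Collect_le continuous_intros)
      moreover have "E \<subseteq> {-R..R}" by (auto simp: E_def)
      ultimately show "compact E" by (metis bounded_closed_interval bounded_subset compact_eq_bounded_closed)
    qed
    have mE: "measure lebesgue E \<le> K * B powr - \<delta>"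
    proof (cases "measure lebesgue E = 0")
      case True then show ?thesis by (simp add: K_def)
    next
      case False
      define m where "m = measure lebesgue E"
      have m: "m > 0" using False by (simp add: m_def zero_less_measure_iff)
      have "c * B * m ^ d \<le> F v * m ^ d"
        using c(2)[of v] m by (intro mult_right_mono) (auto simp: B_def)
      also have "\<dots> \<le> C0 * \<nu>"
        unfolding F_def by (rule sub[OF degq E _ _ m]) (auto simp: E_def m_def)
      finally have "m ^ d \<le> C0 / c * (\<nu> / B)" using c(1) B1 by (simp add: field_simps)
      also have "\<nu> / B = B powr (-1/8)"
        using B1 powr_diff[of B "7/8" 1] by (simp add: \<nu>_def)
      finally have "m powr real d \<le> C0 / c * B powr (-1/8)" using m by (simp add: powr_realpow)
      then have "(m powr real d) powr (1 / real d) \<le> (C0 / c * B powr (-1/8)) powr (1 / real d)"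
        by (intro powr_mono2) auto
      also have "\<dots> = K * B powr - \<delta>"
        using B1 c C0 by (subst powr_mult) (auto simp: K_def \<delta>_def powr_powr field_simps)
      finally show ?thesis using m d1 by (simp add: powr_powr m_def)
    qed
    have "integral {-R..R} (\<lambda>x. \<mu>\<^sup>2 / ((poly (q v) x)\<^sup>2 + \<mu>\<^sup>2))
        \<le> integral {-R..R} (\<lambda>x. indicator E x + \<mu>\<^sup>2 / \<nu>\<^sup>2)"
    proof (rule integral_le)
      have ne: "(poly (q v) x)\<^sup>2 + \<mu>\<^sup>2 > 0" for x using mu by (simp add: add_nonneg_pos)
      then show "(\<lambda>x. \<mu>\<^sup>2 / ((poly (q v) x)\<^sup>2 + \<mu>\<^sup>2)) integrable_on {-R..R}"
        by (intro integrable_continuous_real continuous_intros) (metis less_irrefl)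
      show "(\<lambda>x. indicator E x + \<mu>\<^sup>2 / \<nu>\<^sup>2) integrable_on {-R..R}"
        by (intro integrable_add) (use E in \<open>auto simp: integrable_on_indicator intro: fmeasurable.Int\<close>)
      fix x assume x: "x \<in> {-R..R}"
      show "\<mu>\<^sup>2 / ((poly (q v) x)\<^sup>2 + \<mu>\<^sup>2) \<le> indicator E x + \<mu>\<^sup>2 / \<nu>\<^sup>2"
      proof (cases "x \<in> E")
        case True
        have "\<mu>\<^sup>2 / ((poly (q v) x)\<^sup>2 + \<mu>\<^sup>2) \<le> 1" using ne[of x] by simp
        then show ?thesis using True by (simp add: add_increasing2)
      next
        case False
        then have "\<nu> \<le> \<bar>poly (q v) x\<bar>" using x by (auto simp: E_def)
        then have "\<nu>\<^sup>2 \<le> (poly (q v) x)\<^sup>2" using mu by (metis abs_le_square_iff abs_of_pos)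
        then have "\<mu>\<^sup>2 / ((poly (q v) x)\<^sup>2 + \<mu>\<^sup>2) \<le> \<mu>\<^sup>2 / \<nu>\<^sup>2"
          using mu by (intro divide_left_mono) (auto simp: add_increasing2 intro!: mult_pos_pos ne)
        then show ?thesis using False by simp
      qed
    qed
    also have "\<dots> = measure lebesgue E + 2 * R * (\<mu>\<^sup>2 / \<nu>\<^sup>2)"
    proof -
      have "E \<inter> {-R..R} = E" by (auto simp: E_def)
      then have "integral {-R..R} (indicat_real E) = measure lebesgue E" "indicat_real E integrable_on {-R..R}"
        using E integral_indicator[of E "{-R..R}"] integrable_on_indicator[of E "{-R..R}"] by auto
      then show ?thesis using R by (subst Henstock_Kurzweil_Integration.integral_add) auto
    qed
    finally have I: "integral {-R..R} (\<lambda>x. \<mu>\<^sup>2 / ((poly (q v) x)\<^sup>2 + \<mu>\<^sup>2))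
       \<le> measure lebesgue E + 2 * R * (\<mu>\<^sup>2 / \<nu>\<^sup>2)" .
    have le: "B powr s \<le> B powr - \<delta>" if "s \<le> - 1/8" for s
      using that \<delta> B1 by (intro powr_mono) auto
    have mu2: "\<mu>\<^sup>2 = B powr (3/2)" "\<nu>\<^sup>2 = B powr (7/4)"
      using B1 by (simp_all add: \<mu>_def \<nu>_def flip: powr_numeral add: powr_powr)
    have a1: "\<mu>\<^sup>2 / \<nu>\<^sup>2 \<le> B powr - \<delta>" "1 / \<mu> \<le> B powr - \<delta>" "B / \<mu>\<^sup>2 \<le> B powr - \<delta>"
    proof -
      have "\<mu>\<^sup>2 / \<nu>\<^sup>2 = B powr (-1/4)" unfolding mu2 by (subst powr_diff[symmetric]) simp
      then show "\<mu>\<^sup>2 / \<nu>\<^sup>2 \<le> B powr - \<delta>" using le[of "-1/4"] by simp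
      have "1 / \<mu> = B powr (-3/4)" unfolding \<mu>_def using powr_minus_divide[of B "3/4"] by simp
      then show "1 / \<mu> \<le> B powr - \<delta>" using le[of "-3/4"] by simp
      have "B / \<mu>\<^sup>2 = B powr (1 - 3/2)" unfolding mu2 powr_diff using B1 by simp
      then show "B / \<mu>\<^sup>2 \<le> B powr - \<delta>" using le[of "-1/2"] by simp
    qed
    have "norm (integral {-R..R} (\<lambda>x. cis (poly P x)))
       \<le> integral {-R..R} (\<lambda>x. \<mu>\<^sup>2 / ((poly (q v) x)\<^sup>2 + \<mu>\<^sup>2)) + 1 / \<mu> + (R - - R) * (M * B) / \<mu>\<^sup>2"
      unfolding P'[symmetric]
      by (rule norm_integral_cis_poly_le) (use R mu M(2)[of _ v] in \<open>auto simp: P' B_def\<close>)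
    also have "\<dots> \<le> K * B powr - \<delta> + 2 * R * (B powr - \<delta>) + B powr - \<delta> + 2 * R * M * (B powr - \<delta>)"
    proof (intro add_mono)
      have "2 * R * (\<mu>\<^sup>2 / \<nu>\<^sup>2) \<le> 2 * R * (B powr - \<delta>)" using R a1 by (intro mult_left_mono) auto
      then show "integral {-R..R} (\<lambda>x. \<mu>\<^sup>2 / ((poly (q v) x)\<^sup>2 + \<mu>\<^sup>2)) \<le> K * B powr - \<delta> + 2 * R * (B powr - \<delta>)"
        using I mE by linarith
      have "2 * R * M * (B / \<mu>\<^sup>2) \<le> 2 * R * M * (B powr - \<delta>)"
        using R M a1 by (intro mult_left_mono) auto
      then show "(R - - R) * (M * B) / \<mu>\<^sup>2 \<le> 2 * R * M * (B powr - \<delta>)" by (simp add: mult.assoc)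
    qed (use a1 in auto)
    also have "\<dots> = C * B powr - \<delta>" by (simp add: C_def algebra_simps)
    also have "\<dots> \<le> C * \<bar>b i\<bar> powr - \<delta>"
      by (intro mult_left_mono powr_mono2' C) (use \<delta> bi Bb in auto)
    finally show ?thesis by (simp add: P_def poly_sum)
  qed
  moreover have "\<delta> \<le> 1" using \<delta> by simp
  ultimately show ?thesis using C \<delta>(1) by blast
qed

subsection \<open>Almost everywhere convergence from second moments\<close>

text \<open>\<open>s\<close> stands for the norm of a partial sum of terms of modulus at most
  \<open>1\<close>. Between \<open>M j\<close> and \<open>M (Suc j)\<close> it grows by at most the
  gap, and the gap is negligible relative to \<open>M j\<close>.\<close>

lemma tendsto_average_along_gaps:
  fixes s :: "nat \<Rightarrow> real" and M :: "nat \<Rightarrow> nat"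
  assumes M: "\<And>j. M j \<ge> 1" "filterlim M at_top sequentially"
    and ratio: "(\<lambda>j. real (M (Suc j)) / real (M j)) \<longlonglongrightarrow> 1"
    and s0: "\<And>N. s N \<ge> 0" and s: "\<And>m N. m \<le> N \<Longrightarrow> s N \<le> s m + (real N - real m)"
    and lim: "(\<lambda>j. s (M j) / real (M j)) \<longlonglongrightarrow> 0"
  shows "(\<lambda>N. s N / real N) \<longlonglongrightarrow> 0"
proof (rule LIMSEQ_I)
  fix e :: real assume e: "e > 0"
  have "\<forall>\<^sub>F j in sequentially. s (M j) / real (M j) < e / 2"
    using lim e by (intro order_tendstoD(2)[OF lim]) simp
  moreover have "\<forall>\<^sub>F j in sequentially. real (M (Suc j)) / real (M j) < 1 + e / 2"
    using e by (intro order_tendstoD(2)[OF ratio]) simp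
  ultimately obtain J where J: "\<And>j. j \<ge> J \<Longrightarrow> s (M j) / real (M j) < e / 2 \<and> real (M (Suc j)) / real (M j) < 1 + e / 2"
    by (metis (no_types, lifting) eventually_conj eventually_sequentially)
  have "norm (s N / real N - 0) < e" if N: "N \<ge> M J" for N
  proof -
    have "\<exists>k\<ge>J. N < M k"
      using M(2)[unfolded filterlim_at_top, rule_format, of "Suc N"] unfolding eventually_sequentially by (metis Suc_le_lessD nle_le)
    \<comment> \<open>\<open>N \<ge> M J\<close> rules out \<open>k = J\<close>, so the least such
      \<open>k\<close> has a predecessor \<open>j \<ge> J\<close>; minimality gives
      \<open>M j \<le> N\<close>, which brackets \<open>N\<close>.\<close>
    define k where "k = (LEAST k. k \<ge> J \<and> N < M k)"
    have k: "k \<ge> J" "N < M k" unfolding k_def using LeastI_ex[OF \<open>\<exists>k\<ge>J. N < M k\<close>[unfolded Bex_def]]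
      by auto
    have "k \<noteq> J" using k N by auto
    then obtain j where j: "k = Suc j" "j \<ge> J" using k(1) by (cases k) auto
    have Mj: "M j \<le> N"
      using not_less_Least[of j "\<lambda>k. k \<ge> J \<and> N < M k"] j unfolding k_def[symmetric] by auto
    have p: "real (M j) > 0" using M(1)[of j] by simp
    have "s N / real N \<le> s N / real (M j)"
      using Mj p s0 by (intro divide_left_mono) auto
    also have "\<dots> \<le> (s (M j) + (real (M (Suc j)) - real (M j))) / real (M j)"
      using s[OF Mj] k j p by (intro divide_right_mono) auto
    also have "\<dots> = s (M j) / real (M j) + (real (M (Suc j)) / real (M j) - 1)"
      using p by (simp add: field_simps)
    also have "\<dots> < e" using J[OF j(2)] by linarith
    finally show ?thesis using s0[of N] by simp
  qed
  then show "\<exists>no. \<forall>n\<ge>no. norm (s n / real n - 0) < e" by blast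
qed

text \<open>By Tonelli the sum of all \<open>G j\<close> has finite integral, hence is finite almost
  everywhere, and the terms of a convergent series tend to \<open>0\<close>.\<close>

lemma AE_tendsto_0_of_summable_nn_integral:
  fixes G :: "nat \<Rightarrow> 'a \<Rightarrow> real"
  assumes [measurable]: "\<And>j. G j \<in> borel_measurable M" and G0: "\<And>j x. G j x \<ge> 0"
    and B: "\<And>j. (\<integral>\<^sup>+x. ennreal (G j x) \<partial>M) \<le> ennreal (B j)" "\<And>j. B j \<ge> 0" "summable B"
  shows "AE x in M. (\<lambda>j. G j x) \<longlonglongrightarrow> 0"
proof -
  have "(\<integral>\<^sup>+x. (\<Sum>j. ennreal (G j x)) \<partial>M) = (\<Sum>j. \<integral>\<^sup>+x. ennreal (G j x) \<partial>M)"
    by (intro nn_integral_suminf) measurable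
  also have "\<dots> \<le> (\<Sum>j. ennreal (B j))" by (intro suminf_le B(1) summableI)
  also have "\<dots> < \<infinity>" by (subst suminf_ennreal2[OF B(2,3)]) simp
  finally have "AE x in M. (\<Sum>j. ennreal (G j x)) \<noteq> \<infinity>"
    by (intro nn_integral_PInf_AE) auto
  then show ?thesis
  proof eventually_elim
    case (elim x)
    then have "summable (\<lambda>j. G j x)" by (intro summable_suminf_not_top G0) auto
    then show ?case by (rule summable_LIMSEQ_zero)
  qed
qed

lemma powr_gap_tendsto_0:
  fixes c :: real
  assumes "0 < c" "c < 1"
  shows "(\<lambda>j. real (Suc j) powr c - real j powr c) \<longlonglongrightarrow> 0"
  using assms by real_asymp

text \<open>The sequence is \<open>exp (j powr c)\<close> rounded down. The factor
  \<open>1 / 2\<close> in the logarithmic bound leaves room for the rounding.\<close>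

lemma subexponential_sequence:
  fixes c :: real
  assumes c: "0 < c" "c < 1"
  obtains M :: "nat \<Rightarrow> nat" where "\<And>j. M j \<ge> 1" "filterlim M at_top sequentially"
    "(\<lambda>j. real (M (Suc j)) / real (M j)) \<longlonglongrightarrow> 1"
    "\<forall>\<^sub>F j in sequentially. ln (real (M j)) \<ge> real j powr c / 2"
proof -
  define M where "M = (\<lambda>j. nat \<lfloor>exp (real j powr c)\<rfloor>)"
  have ub: "real (M j) \<le> exp (real j powr c)" for j
    by (simp add: M_def)
  have lb: "real (M j) \<ge> exp (real j powr c) - 1" for j
    unfolding M_def by linarith
  have "exp (real j powr c) \<ge> 1" for j by simp
  then have M1: "M j \<ge> 1" for j unfolding M_def by (simp add: le_nat_floor)
  have "filterlim (\<lambda>j. exp (real j powr c) - 1) at_top sequentially" using c by real_asymp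
  then have "filterlim (\<lambda>j. real (M j)) at_top sequentially"
    by (rule filterlim_at_top_mono) (use lb in auto)
  then have Mtop: "filterlim M at_top sequentially"
    by (simp add: filterlim_sequentially_iff_filterlim_real)
  have M_pos: "real (M j) > 0" for j using M1[of j] by simp
  have "filterlim (\<lambda>j. real j powr c) at_top sequentially" using c by real_asymp
  \<comment> \<open>The threshold \<open>2\<close> makes \<open>t = exp (j powr c / 2)\<close> at
    least \<open>2\<close>, whence \<open>t * t - 1 \<ge> t\<close>, which gives the logarithmic
    bound. It also keeps the denominator positive in the ratio estimate below.\<close>
  then have ev: "\<forall>\<^sub>F j in sequentially. real j powr c \<ge> 2" by (simp add: filterlim_at_top)
  then have Mln: "\<forall>\<^sub>F j in sequentially. ln (real (M j)) \<ge> real j powr c / 2"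
  proof eventually_elim
    case (elim j)
    define t where "t = exp (real j powr c / 2)"
    have "t \<ge> 1 + real j powr c / 2" unfolding t_def by (rule exp_ge_add_one_self)
    then have t: "t \<ge> 2" using elim by simp
    have "exp (real j powr c) = t * t" by (simp add: t_def flip: exp_add)
    moreover have "t * t \<ge> 2 * t" using t by (intro mult_right_mono) auto
    ultimately have "real (M j) \<ge> t" using lb[of j] t by linarith
    then have "ln (real (M j)) \<ge> ln t" using t M_pos by simp
    then show ?case by (simp add: t_def)
  qed
  have mono: "M j \<le> M (Suc j)" for j
    unfolding M_def by (intro nat_mono floor_mono) (use c in \<open>auto intro!: powr_mono2\<close>)
  have Mratio: "(\<lambda>j. real (M (Suc j)) / real (M j)) \<longlonglongrightarrow> 1"
  proof (rule tendsto_sandwich)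
    show "\<forall>\<^sub>F j in sequentially. 1 \<le> real (M (Suc j)) / real (M j)"
      using mono M_pos by (intro always_eventually allI) (simp add: field_simps)
    show "\<forall>\<^sub>F j in sequentially. real (M (Suc j)) / real (M j)
        \<le> exp (real (Suc j) powr c - real j powr c) / (1 - exp (- (real j powr c)))"
      using ev
    proof eventually_elim
      case (elim j)
      define t where "t = exp (real j powr c)"
      have "t \<ge> 1 + real j powr c" unfolding t_def by (rule exp_ge_add_one_self)
      then have t: "t \<ge> 2" using elim by simp
      have "real (M (Suc j)) / real (M j) \<le> exp (real (Suc j) powr c) / (t - 1)"
      proof (rule frac_le)
        show "t - 1 \<le> real (M j)" using lb[of j] by (simp only: t_def)
        show "0 < t - 1" using t by simp
      qed (use ub[of "Suc j"] in auto)
      also have "\<dots> = (exp (real (Suc j) powr c) / t) / (1 - 1 / t)"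
        using t by (simp add: divide_simps)
      finally show ?case by (simp add: t_def exp_diff exp_minus field_simps)
    qed
    have "(\<lambda>j. exp (- (real j powr c))) \<longlonglongrightarrow> 0" using c by real_asymp
    then have "(\<lambda>j. exp (real (Suc j) powr c - real j powr c) / (1 - exp (- (real j powr c)))) \<longlonglongrightarrow> exp 0 / (1 - 0)"
      by (intro tendsto_intros powr_gap_tendsto_0 c) auto
    then show "(\<lambda>j. exp (real (Suc j) powr c - real j powr c) / (1 - exp (- (real j powr c)))) \<longlonglongrightarrow> 1"
      by simp
  qed auto
  show thesis by (rule that[OF M1 Mtop Mratio Mln])
qed

text \<open>The logarithmic gain in the second moment is summable along \<open>exp (j powr c)\<close> with
  \<open>c < 1 < c * (1 + \<epsilon>)\<close>, and \<open>c < 1\<close> makes the gaps of this sequence negligible.\<close>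

lemma AE_average_tendsto_0:
  fixes f :: "nat \<Rightarrow> real \<Rightarrow> complex"
  assumes cont: "\<And>n. continuous_on UNIV (f n)" and f1: "\<And>n x. norm (f n x) \<le> 1"
    and \<epsilon>: "\<epsilon> > 0" and K: "K \<ge> 0"
    and bound: "\<forall>\<^sub>F N in sequentially. integral {u..v} (\<lambda>x. (norm (\<Sum>n\<in>{1..N}. f n x))\<^sup>2)
                 \<le> K * (real N)\<^sup>2 / ln (real N) powr (1 + \<epsilon>)"
  shows "AE x in lebesgue. x \<in> {u..v} \<longrightarrow> (\<lambda>N. (\<Sum>n\<in>{1..N}. f n x) / of_nat N) \<longlonglongrightarrow> 0"
proof -
  define c where "c = (1 + \<epsilon> / 2) / (1 + \<epsilon>)"
  have c: "0 < c" "c < 1" "c * (1 + \<epsilon>) = 1 + \<epsilon> / 2" using \<epsilon> by (auto simp: c_def)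
  obtain M :: "nat \<Rightarrow> nat" where sub: "\<And>j. M j \<ge> 1" "filterlim M at_top sequentially"
      "(\<lambda>j. real (M (Suc j)) / real (M j)) \<longlonglongrightarrow> 1"
      "\<forall>\<^sub>F j in sequentially. ln (real (M j)) \<ge> real j powr c / 2"
    by (rule subexponential_sequence[OF c(1,2)]) blast
  define s where "s N x = norm (\<Sum>n\<in>{1..N}. f n x)" for N x
  define G where "G j x = indicator {u..v} x * (s (M j) x / real (M j))\<^sup>2" for j x
  have conts: "continuous_on S (s N)" for N S
    unfolding s_def by (intro continuous_intros continuous_on_subset[OF cont]) auto
  have [measurable]: "s N \<in> borel_measurable borel" for N
    by (intro borel_measurable_continuous_onI conts)
  have Gm: "G j \<in> borel_measurable lborel" for j unfolding G_def by measurable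
  define I where "I j = integral {u..v} (\<lambda>x. (s (M j) x / real (M j))\<^sup>2)" for j
  have nnI: "(\<integral>\<^sup>+x. ennreal (G j x) \<partial>lborel) = ennreal (I j)" for j
  proof -
    have "((\<lambda>x. (s (M j) x / real (M j))\<^sup>2) has_integral I j) {u..v}"
      unfolding I_def divide_inverse
      by (intro integrable_integral integrable_continuous_real continuous_intros conts)
    then show ?thesis
      unfolding G_def by (rule nn_integral_has_integral_lebesgue[rotated]) simp
  qed
  have I0: "I j \<ge> 0" for j
    unfolding I_def divide_inverse
    by (intro integral_nonneg integrable_continuous_real continuous_intros conts) auto
  have ev1: "\<forall>\<^sub>F j in sequentially. integral {u..v} (\<lambda>x. (s (M j) x)\<^sup>2)
      \<le> K * (real (M j))\<^sup>2 / ln (real (M j)) powr (1 + \<epsilon>)"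
    using eventually_compose_filterlim[OF bound sub(2)] unfolding s_def .
  have "\<forall>\<^sub>F j in sequentially. norm (I j) \<le> K * 2 powr (1 + \<epsilon>) * real j powr (- (1 + \<epsilon> / 2))"
    using ev1 sub(4) eventually_gt_at_top[of 0]
  proof eventually_elim
    case (elim j)
    have Mp: "real (M j) > 0" using sub(1)[of j] by simp
    have "I j = integral {u..v} (\<lambda>x. (s (M j) x)\<^sup>2) / (real (M j))\<^sup>2"
      unfolding I_def by (simp add: power_divide)
    also have "\<dots> \<le> K / ln (real (M j)) powr (1 + \<epsilon>)"
    proof -
      have "integral {u..v} (\<lambda>x. (s (M j) x)\<^sup>2) / (real (M j))\<^sup>2
          \<le> K * (real (M j))\<^sup>2 / ln (real (M j)) powr (1 + \<epsilon>) / (real (M j))\<^sup>2"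
        using elim(1) by (rule divide_right_mono) simp
      then show ?thesis using Mp by simp
    qed
    also have "\<dots> \<le> K / (real j powr c / 2) powr (1 + \<epsilon>)"
    proof (intro divide_left_mono powr_mono2 mult_pos_pos)
      have "real j powr c / 2 > 0" using elim by simp
      then show "0 < ln (real (M j)) powr (1 + \<epsilon>)" using elim by (simp only: powr_gt_zero)
    qed (use elim K \<epsilon> in auto)
    also have "\<dots> = K * 2 powr (1 + \<epsilon>) * real j powr (- (1 + \<epsilon> / 2))"
    proof -
      have "(real j powr c / 2) powr (1 + \<epsilon>) = real j powr (1 + \<epsilon> / 2) / 2 powr (1 + \<epsilon>)"
        unfolding c(3)[symmetric] by (simp only: powr_divide powr_powr powr_ge_zero zero_le_numeral)
      then show ?thesis by (simp only: powr_minus divide_inverse inverse_mult_distrib inverse_inverse_eq mult_ac)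
    qed
    finally show ?case using I0[of j] by simp
  qed
  moreover have "summable (\<lambda>j. K * 2 powr (1 + \<epsilon>) * real j powr (- (1 + \<epsilon> / 2)))"
    using \<epsilon> by (intro summable_mult) (simp add: summable_real_powr_iff)
  ultimately have "summable I" by (rule summable_comparison_test_ev)
  then have "AE x in lborel. (\<lambda>j. G j x) \<longlonglongrightarrow> 0"
    by (intro AE_tendsto_0_of_summable_nn_integral[where B = I] Gm) (auto simp: nnI I0, auto simp: G_def)
  \<comment> \<open>The functions \<open>G j\<close> are Borel, so Tonelli was applied over
    \<open>lborel\<close>; a null set there remains null in the completion.\<close>
  then have "AE x in lebesgue. (\<lambda>j. G j x) \<longlonglongrightarrow> 0" by (rule AE_completion)
  then show ?thesis
  proof eventually_elim
    case (elim x)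
    show ?case
    proof
      assume x: "x \<in> {u..v}"
      have "(\<lambda>j. sqrt (G j x)) \<longlonglongrightarrow> sqrt 0" by (intro tendsto_intros elim)
      moreover have "sqrt (G j x) = s (M j) x / real (M j)" for j
        using x by (simp add: G_def s_def)
      ultimately have lim: "(\<lambda>j. s (M j) x / real (M j)) \<longlonglongrightarrow> 0" by simp
      have "(\<lambda>N. s N x / real N) \<longlonglongrightarrow> 0"
      proof (rule tendsto_average_along_gaps[OF sub(1-3) _ _ lim])
        fix m N :: nat assume mN: "m \<le> N"
        have "(\<Sum>n\<in>{1..N}. f n x) = (\<Sum>n\<in>{1..m}. f n x) + (\<Sum>n\<in>{m<..N}. f n x)"
          using mN by (subst sum.union_disjoint[symmetric]) (auto intro!: sum.cong)
        then have "s N x \<le> s m x + norm (\<Sum>n\<in>{m<..N}. f n x)"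
          unfolding s_def by (simp add: norm_triangle_ineq)
        also have "norm (\<Sum>n\<in>{m<..N}. f n x) \<le> (\<Sum>n\<in>{m<..N}. 1)"
          by (intro sum_norm_le f1)
        finally show "s N x \<le> s m x + (real N - real m)" using mN by (simp add: of_nat_diff)
      qed (simp add: s_def)
      then show "(\<lambda>N. (\<Sum>n\<in>{1..N}. f n x) / of_nat N) \<longlonglongrightarrow> 0"
        by (subst tendsto_norm_zero_iff[symmetric]) (simp add: s_def norm_divide)
    qed
  qed
qed

section \<open>Second moment of the exponential averages\<close>

lemma integral_norm_square_sum_le:
  fixes f :: "nat \<Rightarrow> real \<Rightarrow> complex"
  assumes cont: "\<And>n. continuous_on {u..v} (f n)"
  shows "integral {u..v} (\<lambda>x. (norm (\<Sum>n\<in>A. f n x))\<^sup>2)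
           \<le> (\<Sum>m\<in>A. \<Sum>n\<in>A. norm (integral {u..v} (\<lambda>x. f m x * cnj (f n x))))"
proof (cases "finite A")
  case True
  have int: "(\<lambda>x. f m x * cnj (f n x)) integrable_on {u..v}" for m n
    by (intro integrable_continuous_real continuous_intros cont)
  have int2: "(\<lambda>x. (norm (\<Sum>n\<in>A. f n x))\<^sup>2) integrable_on {u..v}"
    by (intro integrable_continuous_real continuous_intros cont)
  have "complex_of_real ((norm (\<Sum>n\<in>A. f n x))\<^sup>2) = (\<Sum>m\<in>A. \<Sum>n\<in>A. f m x * cnj (f n x))" for x
    by (simp only: complex_norm_square cnj_sum sum_product)
  then have "complex_of_real (integral {u..v} (\<lambda>x. (norm (\<Sum>n\<in>A. f n x))\<^sup>2))
      = integral {u..v} (\<lambda>x. \<Sum>m\<in>A. \<Sum>n\<in>A. f m x * cnj (f n x))"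
    using integral_linear[OF int2, of complex_of_real] by (simp add: o_def bounded_linear_of_real)
  also have "\<dots> = (\<Sum>m\<in>A. \<Sum>n\<in>A. integral {u..v} (\<lambda>x. f m x * cnj (f n x)))"
    using True by (simp add: integral_sum integrable_sum int)
  finally have eq: "complex_of_real (integral {u..v} (\<lambda>x. (norm (\<Sum>n\<in>A. f n x))\<^sup>2))
      = (\<Sum>m\<in>A. \<Sum>n\<in>A. integral {u..v} (\<lambda>x. f m x * cnj (f n x)))" .
  have "integral {u..v} (\<lambda>x. (norm (\<Sum>n\<in>A. f n x))\<^sup>2)
      \<le> norm (complex_of_real (integral {u..v} (\<lambda>x. (norm (\<Sum>n\<in>A. f n x))\<^sup>2)))"
    unfolding norm_of_real by (rule abs_ge_self)
  also have "\<dots> \<le> (\<Sum>m\<in>A. \<Sum>n\<in>A. norm (integral {u..v} (\<lambda>x. f m x * cnj (f n x))))"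
    unfolding eq by (intro sum_norm_le order_refl)
  finally show ?thesis .
qed simp

text \<open>The second moment runs over all pairs, scatteredness only over \<open>m < n\<close>.
  Symmetry doubles the triangle, and the diagonal costs \<open>c\<close> per index.\<close>

lemma sum_square_sym_le:
  fixes g t :: "nat \<Rightarrow> nat \<Rightarrow> real"
  assumes "\<And>m n. g m n \<le> t m n" "\<And>m n. t m n = t n m" "\<And>n. t n n = c"
  shows "(\<Sum>m\<in>{1..N}. \<Sum>n\<in>{1..N}. g m n)
    \<le> c * real N + 2 * (\<Sum>(m, n) \<in> {(m, n). 1 \<le> m \<and> m < n \<and> n \<le> N}. t m n)"
proof -
  define L where "L = {(m, n). 1 \<le> m \<and> m < n \<and> n \<le> N}"
  define D where "D = (\<lambda>n. (n, n)) ` {1..N}"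
  have finL: "finite L" by (rule finite_subset[of _ "{1..N} \<times> {1..N}"]) (auto simp: L_def)
  have split: "{1..N} \<times> {1..N} = (L \<union> prod.swap ` L) \<union> D"
    by (auto simp: L_def D_def image_iff)
  have "(\<Sum>m\<in>{1..N}. \<Sum>n\<in>{1..N}. g m n) \<le> (\<Sum>m\<in>{1..N}. \<Sum>n\<in>{1..N}. t m n)"
    by (intro sum_mono assms)
  also have "\<dots> = (\<Sum>(m, n)\<in>{1..N} \<times> {1..N}. t m n)" by (simp add: sum.cartesian_product)
  also have "\<dots> = (\<Sum>(m, n)\<in>L \<union> prod.swap ` L. t m n) + (\<Sum>(m, n)\<in>D. t m n)"
    unfolding split by (rule sum.union_disjoint) (use finL in \<open>auto simp: L_def D_def\<close>)
  also have "(\<Sum>(m, n)\<in>L \<union> prod.swap ` L. t m n) = (\<Sum>(m, n)\<in>L. t m n) + (\<Sum>(m, n)\<in>prod.swap ` L. t m n)"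
    by (rule sum.union_disjoint) (use finL in \<open>auto simp: L_def\<close>)
  also have "(\<Sum>(m, n)\<in>prod.swap ` L. t m n) = (\<Sum>(m, n)\<in>L. t m n)"
    by (subst sum.reindex) (auto simp: case_prod_beta assms(2) intro!: sum.cong)
  also have "(\<Sum>(m, n)\<in>D. t m n) = c * real N"
    unfolding D_def by (subst sum.reindex) (auto simp: assms(3) inj_on_def)
  finally show ?thesis by (simp add: L_def)
qed

text \<open>Only the sequence with index \<open>j\<close> is used quantitatively. The decay
  constants come from a bounded interval, so the claim is first shown on each \<open>{-R..R}\<close>
  and then on the line as a countable union.\<close>

lemma AE_exponential_average_tendsto_0:
  fixes p :: "'k::finite \<Rightarrow> real poly" and h :: "'k \<Rightarrow> int"
  assumes indep: "lin_indep_with_one p" and scat: "\<And>i. scattered (a i)" and h: "h j \<noteq> 0"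
  shows "AE x in lebesgue. (\<lambda>N. (\<Sum>n\<in>{1..N}.
    cis (2 * pi * (\<Sum>i\<in>UNIV. of_int (h i) * (a i n * poly (p i) x)))) / of_nat N) \<longlonglongrightarrow> 0"
proof -
  define f where "f n x = cis (2 * pi * (\<Sum>i\<in>UNIV. of_int (h i) * (a i n * poly (p i) x)))" for n x
  have cont: "continuous_on S (f n)" for S n
    unfolding f_def by (intro continuous_intros)
  have loc: "AE x in lebesgue. x \<in> {-real R..real R} \<longrightarrow> (\<lambda>N. (\<Sum>n\<in>{1..N}. f n x) / of_nat N) \<longlonglongrightarrow> 0"
    for R :: nat
  proof -
    obtain C \<delta> where C: "C \<ge> 0" "0 < \<delta>" "\<delta> \<le> 1"
      and dec: "\<And>b i. \<bar>b i\<bar> \<ge> 1 \<Longrightarrow>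
           norm (integral {-real R..real R} (\<lambda>x. cis (\<Sum>i\<in>UNIV. b i * poly (p i) x))) \<le> C * \<bar>b i\<bar> powr - \<delta>"
      using norm_integral_cis_lin_comb_le[OF indep, of "real R"] by auto
    from scat[of j] C obtain \<epsilon> where \<epsilon>: "\<epsilon> > 0" and ev: "\<forall>\<^sub>F N in sequentially.
        1 / (real N)\<^sup>2 * (\<Sum>(m, n) \<in> {(m, n). 1 \<le> m \<and> m < n \<and> n \<le> N}.
             if a j n = a j m then 1 else min (\<bar>a j n - a j m\<bar> powr (- \<delta>)) 1) \<le> 1 / (ln (real N)) powr (1 + \<epsilon>)"
      unfolding scattered_def delta_scattered_def by blast
    define t where "t m n = (if a j n = a j m then 1 else min (\<bar>a j n - a j m\<bar> powr (- \<delta>)) 1)" for m n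
    \<comment> \<open>\<open>C\<close> serves the pairs whose difference is at least
      \<open>1\<close>; for closer pairs \<open>t = 1\<close>, and the length \<open>2 * R\<close>
      of the interval is the trivial bound.\<close>
    define K where "K = max C (2 * real R)"
    have K: "K \<ge> C" "K \<ge> 2 * real R" "K \<ge> 0" using C by (auto simp: K_def)
    have bd: "norm (integral {-real R..real R} (\<lambda>x. f m x * cnj (f n x))) \<le> K * t m n" for m n
    proof -
      define b where "b i = 2 * pi * of_int (h i) * (a i m - a i n)" for i
      have eq: "f m x * cnj (f n x) = cis (\<Sum>i\<in>UNIV. b i * poly (p i) x)" for x
        by (simp add: f_def b_def cis_cnj cis_mult algebra_simps sum_subtractf sum_distrib_left)
      show ?thesis
      proof (cases "\<bar>a j n - a j m\<bar> \<ge> 1")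
        case True
        have "1 \<le> \<bar>2 * pi * real_of_int (h j)\<bar>"
        proof -
          have "1 \<le> \<bar>real_of_int (h j)\<bar>" using h by linarith
          moreover have "1 \<le> 2 * pi" using pi_ge_two by linarith
          ultimately have "1 * 1 \<le> (2 * pi) * \<bar>real_of_int (h j)\<bar>" by (intro mult_mono) auto
          then show ?thesis by (simp add: abs_mult)
        qed
        then have bj: "\<bar>a j n - a j m\<bar> \<le> \<bar>b j\<bar>"
          unfolding b_def abs_mult[of _ "a j m - a j n"]
          by (metis abs_ge_zero abs_minus_commute mult_right_mono mult_1)
        have "norm (integral {-real R..real R} (\<lambda>x. f m x * cnj (f n x))) \<le> C * \<bar>b j\<bar> powr - \<delta>"
          unfolding eq by (rule dec) (use True bj in linarith)
        also have "\<dots> \<le> K * \<bar>a j n - a j m\<bar> powr - \<delta>"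
          by (intro mult_mono powr_mono2') (use True bj C K in auto)
        also have "\<bar>a j n - a j m\<bar> powr - \<delta> = t m n"
        proof -
          have "\<bar>a j n - a j m\<bar> powr - \<delta> \<le> 1"
            using powr_mono2'[of "-\<delta>" 1 "\<bar>a j n - a j m\<bar>"] True C by simp
          then show ?thesis using True by (auto simp: t_def)
        qed
        finally show ?thesis .
      next
        case False
        have t1: "t m n = 1"
        proof (cases "a j n = a j m")
          case False
          then have "1 \<le> \<bar>a j n - a j m\<bar> powr - \<delta>"
            using powr_mono2'[of "-\<delta>" "\<bar>a j n - a j m\<bar>" 1] \<open>\<not> 1 \<le> _\<close> C by simp
          then show ?thesis by (simp add: t_def)
        qed (simp add: t_def)
        have "norm (integral {-real R..real R} (\<lambda>x. f m x * cnj (f n x))) \<le> integral {-real R..real R} (\<lambda>x. 1)"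
          unfolding eq
          by (rule integral_norm_bound_integral) (auto intro!: integrable_continuous_real continuous_intros)
        then show ?thesis using K t1 by simp
      qed
    qed
    \<comment> \<open>This absorbs the diagonal \<open>K * N\<close>; together with the two
      triangles it yields the factor \<open>3 * K\<close>.\<close>
    have "\<forall>\<^sub>F N in sequentially. real N \<le> (real N)\<^sup>2 / ln (real N) powr (1 + \<epsilon>)"
      using \<epsilon> by real_asymp
    with ev have "\<forall>\<^sub>F N in sequentially. integral {-real R..real R} (\<lambda>x. (norm (\<Sum>n\<in>{1..N}. f n x))\<^sup>2)
                 \<le> (3 * K) * (real N)\<^sup>2 / ln (real N) powr (1 + \<epsilon>)"
      using eventually_gt_at_top[of 0]
    proof eventually_elim
      case (elim N)
      define X where "X = (real N)\<^sup>2 / ln (real N) powr (1 + \<epsilon>)"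
      define T where "T = (\<Sum>(m, n) \<in> {(m, n). 1 \<le> m \<and> m < n \<and> n \<le> N}. t m n)"
      have "1 / (real N)\<^sup>2 * T \<le> 1 / (ln (real N)) powr (1 + \<epsilon>)"
        using elim(1) by (simp only: T_def t_def)
      then have "(real N)\<^sup>2 * (1 / (real N)\<^sup>2 * T) \<le> (real N)\<^sup>2 * (1 / (ln (real N)) powr (1 + \<epsilon>))"
        by (rule mult_left_mono) simp
      then have T: "T \<le> X" using elim(3) by (simp add: X_def)
      have "integral {-real R..real R} (\<lambda>x. (norm (\<Sum>n\<in>{1..N}. f n x))\<^sup>2)
         \<le> (\<Sum>m\<in>{1..N}. \<Sum>n\<in>{1..N}. norm (integral {-real R..real R} (\<lambda>x. f m x * cnj (f n x))))"
        by (rule integral_norm_square_sum_le[OF cont])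
      also have "\<dots> \<le> K * real N + 2 * (\<Sum>(m, n) \<in> {(m, n). 1 \<le> m \<and> m < n \<and> n \<le> N}. K * t m n)"
        by (rule sum_square_sym_le[OF bd]) (auto simp: t_def abs_minus_commute)
      also have "\<dots> = K * real N + 2 * (K * T)"
        by (simp add: T_def sum_distrib_left case_prod_beta)
      also have "\<dots> \<le> K * X + 2 * (K * X)"
        by (intro add_mono mult_left_mono T) (use K elim(2) in \<open>auto simp: X_def\<close>)
      finally show ?case by (simp add: X_def)
    qed
    then show ?thesis
      by (intro AE_average_tendsto_0[OF cont _ \<epsilon>, where K = "3 * K"]) (use K in \<open>auto simp: f_def\<close>)
  qed
  then have "AE x in lebesgue. \<forall>R::nat. x \<in> {-real R..real R} \<longrightarrow> (\<lambda>N. (\<Sum>n\<in>{1..N}. f n x) / of_nat N) \<longlonglongrightarrow> 0"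
    by (simp only: AE_all_countable) blast
  then show ?thesis
  proof eventually_elim
    case (elim x)
    obtain R :: nat where "\<bar>x\<bar> \<le> real R" using real_arch_simple by blast
    then have "x \<in> {-real R..real R}" by (auto simp: abs_le_iff)
    then have "(\<lambda>N. (\<Sum>n\<in>{1..N}. f n x) / of_nat N) \<longlonglongrightarrow> 0" using elim by blast
    then show ?case unfolding f_def .
  qed
qed

subsection \<open>Weyl's criterion on the torus\<close>

text \<open>The open cube serves as fundamental domain: \<open>torus_emb\<close> is injective on it,
  and the omitted faces are null sets.\<close>

abbreviation unit_box :: "(real ^ 'k) set" where
  "unit_box \<equiv> box 0 (\<chi> i. 1)"

text \<open>This realises the torus as a compact subset of a Euclidean space, so that
  Stone-Weierstrass for polynomials applies to periodic functions.\<close>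

definition torus_emb :: "real ^ 'k \<Rightarrow> complex ^ 'k" where
  "torus_emb y = (\<chi> i. cis (2 * pi * y $ i))"

definition torus :: "(complex ^ 'k) set" where
  "torus = {z. \<forall>i. norm (z $ i) = 1}"

lemma cis_sum: "cis (\<Sum>i\<in>A. f i) = (\<Prod>i\<in>A. cis (f i))"
  by (induction A rule: infinite_finite_induct) (auto simp flip: cis_mult)

lemma set_integral_unit_interval_cis:
  "set_integrable lborel {0<..<1} (\<lambda>t. cis (c * t))"
  "c \<noteq> 0 \<Longrightarrow> c / (2 * pi) \<in> \<int> \<Longrightarrow> (LINT t:{0<..<1}|lborel. cis (c * t)) = 0"
proof -
  have "set_integrable lborel {0..1} (\<lambda>t. cis (c * t))"
    unfolding set_integrable_def by (intro borel_integrable_compact continuous_intros) auto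
  then show int: "set_integrable lborel {0<..<1} (\<lambda>t. cis (c * t))"
    by (rule set_integrable_subset) auto
  assume c: "c \<noteq> 0" "c / (2 * pi) \<in> \<int>"
  have "((\<lambda>t. cis (c * t) / (\<i> * c)) has_vector_derivative cis (c * t)) (at t within S)" for t S
  proof -
    have "((\<lambda>t. c * t) has_derivative (*) c) (at t within S)"
      by (auto intro!: derivative_eq_intros)
    then have "((\<lambda>t. cis (c * t)) has_vector_derivative \<i> * c * cis (c * t)) (at t within S)"
      unfolding has_vector_derivative_def
      by (rule has_derivative_eq_rhs[OF has_derivative_cis]) (auto simp: scaleR_conv_of_real)
    then have "((\<lambda>t. cis (c * t) / (\<i> * c)) has_vector_derivative \<i> * c * cis (c * t) / (\<i> * c)) (at t within S)"
      by (rule has_vector_derivative_divide)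
    then show ?thesis using c by simp
  qed
  then have "((\<lambda>t. cis (c * t)) has_integral (cis (c * 1) / (\<i> * c) - cis (c * 0) / (\<i> * c))) {0..1}"
    by (intro fundamental_theorem_of_calculus) auto
  moreover have "cis c = 1" using cis_multiple_2pi[OF c(2)] by simp
  ultimately have "integral {0..1} (\<lambda>t. cis (c * t)) = 0" by (simp add: integral_unique)
  then show "(LINT t:{0<..<1}|lborel. cis (c * t)) = 0"
    by (simp add: set_borel_integral_eq_integral(2)[OF int] flip: integral_open_interval_real)
qed

lemma one_inner_Basis: "b \<in> (Basis :: (real ^ 'k) set) \<Longrightarrow> (\<chi> i. 1) \<bullet> b = 1"
  by (auto simp: Basis_vec_def inner_axis)

text \<open>The character and the indicator of the cube factor over coordinates; by Fubini the
  integral is a product, and a coordinate with \<open>w $ i \<noteq> 0\<close> contributes a full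
  period, hence \<open>0\<close>.\<close>

lemma set_integral_unit_box_cis:
  fixes w :: "real ^ 'k"
  assumes w: "\<And>i. w $ i \<in> \<int>" "w \<noteq> 0"
  shows "(LINT y:unit_box|lborel. cis (2 * pi * (w \<bullet> y))) = 0"
proof -
  let ?g = "\<lambda>b t. indicator {0<..<1} t *\<^sub>R cis (2 * pi * (w \<bullet> b) * t)"
  interpret product_sigma_finite "\<lambda>_. lborel :: real measure" by standard
  have "(LINT y:unit_box|lborel. cis (2 * pi * (w \<bullet> y)))
      = (\<integral>f. indicator unit_box (\<Sum>b\<in>Basis. f b *\<^sub>R b) *\<^sub>R cis (2 * pi * (w \<bullet> (\<Sum>b\<in>Basis. f b *\<^sub>R b)))
            \<partial>(\<Pi>\<^sub>M b\<in>(Basis :: (real ^ 'k) set). lborel))"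
    unfolding set_lebesgue_integral_def
  proof (subst lborel_eq, subst integral_distr)
    show "(\<lambda>y::real^'k. indicator unit_box y *\<^sub>R cis (2 * pi * (w \<bullet> y))) \<in> borel_measurable borel"
      by (intro borel_measurable_scaleR borel_measurable_indicator borel_measurable_continuous_onI continuous_intros) auto
  qed simp_all
  also have "\<dots> = (\<integral>f. (\<Prod>b\<in>Basis. ?g b (f b)) \<partial>(\<Pi>\<^sub>M b\<in>(Basis :: (real ^ 'k) set). lborel))"
  proof (rule Bochner_Integration.integral_cong[OF refl])
    fix f :: "real ^ 'k \<Rightarrow> real"
    have "indicator unit_box (\<Sum>b\<in>Basis. f b *\<^sub>R b) = (\<Prod>b\<in>(Basis :: (real ^ 'k) set). indicat_real {0<..<1} (f b))"
    proof (cases "\<forall>b\<in>(Basis :: (real ^ 'k) set). f b \<in> {0<..<1}")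
      case True
      then show ?thesis by (simp add: mem_box one_inner_Basis)
    next
      case False
      then have "\<exists>b\<in>(Basis :: (real ^ 'k) set). indicat_real {0<..<1} (f b) = 0"
        by (metis indicator_simps(2))
      then have "(\<Prod>b\<in>(Basis :: (real ^ 'k) set). indicat_real {0<..<1} (f b)) = 0"
        by (intro prod_zero) auto
      then show ?thesis using False by (auto simp: mem_box one_inner_Basis)
    qed
    moreover have "cis (2 * pi * (w \<bullet> (\<Sum>b\<in>Basis. f b *\<^sub>R b))) = (\<Prod>b\<in>Basis. cis (2 * pi * (w \<bullet> b) * f b))"
      by (simp add: inner_sum_right sum_distrib_left cis_sum mult_ac)
    ultimately show "indicator unit_box (\<Sum>b\<in>Basis. f b *\<^sub>R b) *\<^sub>R cis (2 * pi * (w \<bullet> (\<Sum>b\<in>Basis. f b *\<^sub>R b)))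
       = (\<Prod>b\<in>Basis. ?g b (f b))"
      by (simp add: scaleR_conv_of_real prod.distrib)
  qed
  also have "\<dots> = (\<Prod>b\<in>Basis. \<integral>t. ?g b t \<partial>lborel)"
    by (rule product_integral_prod)
       (use set_integral_unit_interval_cis(1) in \<open>auto simp: set_integrable_def\<close>)
  also have "\<dots> = 0"
  proof -
    from w(2) obtain i where i: "w $ i \<noteq> 0" by (auto simp: vec_eq_iff)
    have "(\<integral>t. ?g (axis i 1) t \<partial>lborel) = 0"
      using set_integral_unit_interval_cis(2)[of "2 * pi * w $ i"] w(1)[of i] i
      by (simp add: set_lebesgue_integral_def inner_axis)
    moreover have "axis i 1 \<in> (Basis :: (real ^ 'k) set)" by simp
    ultimately show ?thesis by (meson finite_Basis prod_zero)
  qed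
  finally show ?thesis .
qed

lemma measure_unit_box: "measure lborel (unit_box :: (real ^ 'k) set) = 1"
proof -
  show ?thesis by (simp add: measure_lborel_box_eq one_inner_Basis)
qed

text \<open>Integer frequencies make every such function periodic. Since addition is the only
  closure rule, linear statements reduce to single characters; closure under products is derived
  from addition of frequencies.\<close>

inductive trig_poly :: "(real ^ 'k \<Rightarrow> complex) \<Rightarrow> bool" where
  trig_poly_mono: "(\<And>i. w $ i \<in> \<int>) \<Longrightarrow> trig_poly (\<lambda>y. c * cis (2 * pi * (w \<bullet> y)))"
| trig_poly_add: "trig_poly f \<Longrightarrow> trig_poly g \<Longrightarrow> trig_poly (\<lambda>y. f y + g y)"

lemma trig_poly_const: "trig_poly (\<lambda>y. c)"
  using trig_poly_mono[of 0 c] by simp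

lemma trig_poly_mult:
  assumes "trig_poly f" "trig_poly g"
  shows "trig_poly (\<lambda>y. f y * g y)"
  using assms
proof (induction f)
  case (trig_poly_mono w c)
  from trig_poly_mono(2) show ?case
  proof (induction g)
    case (trig_poly_mono w' c')
    have "trig_poly (\<lambda>y. (c * c') * cis (2 * pi * ((w + w') \<bullet> y)))"
      by (rule trig_poly.trig_poly_mono) (use trig_poly_mono \<open>\<And>i. w $ i \<in> \<int>\<close> in auto)
    then show ?case by (simp add: cis_mult[symmetric] inner_add_left distrib_left mult_ac)
  next
    case (trig_poly_add f g)
    then show ?case using trig_poly.trig_poly_add by (simp add: distrib_left)
  qed
next
  case (trig_poly_add f1 f2)
  then show ?case using trig_poly.trig_poly_add by (simp add: distrib_right)
qed

lemma trig_poly_sum: "(\<And>i. i \<in> A \<Longrightarrow> trig_poly (f i)) \<Longrightarrow> trig_poly (\<lambda>y. \<Sum>i\<in>A. f i y)"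
  by (induction A rule: infinite_finite_induct) (auto intro: trig_poly_const trig_poly_add)

lemma continuous_on_trig_poly: "trig_poly f \<Longrightarrow> continuous_on S f"
  by (induction rule: trig_poly.induct) (intro continuous_intros; assumption)+

lemma trig_poly_real_polynomial_function:
  assumes "real_polynomial_function (g :: complex ^ 'k \<Rightarrow> real)"
  shows "trig_poly (\<lambda>y. complex_of_real (g (torus_emb y)))"
  using assms
proof (induction g rule: real_polynomial_function.induct)
  case (linear f)
  interpret bounded_linear f by fact
  \<comment> \<open>A real-linear functional of the embedded point is a sum of terms
    \<open>a * cos + b * sin\<close>. Euler's formulas give the frequencies \<open>axis i 1\<close>
    and \<open>axis i (-1)\<close> with coefficients \<open>(a - \<i> * b) / 2\<close> and
    \<open>(a + \<i> * b) / 2\<close>.\<close>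
  have "of_real (f (torus_emb y)) = (\<Sum>i\<in>UNIV. (complex_of_real (f (axis i 1)) - \<i> * of_real (f (axis i \<i>))) / 2 * cis (2 * pi * (axis i 1 \<bullet> y))
      + (complex_of_real (f (axis i 1)) + \<i> * of_real (f (axis i \<i>))) / 2 * cis (2 * pi * (axis i (-1) \<bullet> y)))" for y
  proof -
    have "torus_emb y = (\<Sum>i\<in>UNIV. cos (2 * pi * y $ i) *\<^sub>R axis i 1 + sin (2 * pi * y $ i) *\<^sub>R axis i \<i>)"
      by (simp add: vec_eq_iff torus_emb_def axis_def sum.distrib complex_eq_iff if_distrib cong: if_cong)
    then have "f (torus_emb y) = (\<Sum>i\<in>UNIV. cos (2 * pi * y $ i) * f (axis i 1) + sin (2 * pi * y $ i) * f (axis i \<i>))"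
      by (simp add: sum add scaleR)
    then show ?thesis
      by (simp only: of_real_sum) (intro sum.cong refl, simp add: inner_axis' complex_eq_iff field_simps)
  qed
  moreover have "trig_poly (\<lambda>y. \<Sum>i\<in>UNIV. (complex_of_real (f (axis i 1)) - \<i> * of_real (f (axis i \<i>))) / 2 * cis (2 * pi * (axis i 1 \<bullet> y))
      + (complex_of_real (f (axis i 1)) + \<i> * of_real (f (axis i \<i>))) / 2 * cis (2 * pi * (axis i (-1) \<bullet> y)))"
    by (intro trig_poly_sum trig_poly_add trig_poly_mono) (auto simp: axis_def)
  ultimately show ?case by simp
next
  case (const c)
  show ?case by (rule trig_poly_const)
qed (auto intro: trig_poly_add trig_poly_mult)

lemma continuous_torus_emb: "continuous_on S torus_emb"
  unfolding torus_emb_def by (intro continuous_intros)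

lemma torus_emb_in_torus: "torus_emb y \<in> torus"
  by (simp add: torus_emb_def torus_def)

lemma compact_torus: "compact (torus :: (complex ^ 'k) set)"
proof -
  have "bounded (torus :: (complex ^ 'k) set)"
  proof (rule boundedI)
    fix z :: "complex ^ 'k" assume "z \<in> torus"
    then have "(\<Sum>i\<in>UNIV. norm (z $ i)) = real CARD('k)" by (simp add: torus_def)
    then show "norm z \<le> real CARD('k)"
      using L2_set_le_sum[of UNIV "\<lambda>i. norm (z $ i)"] by (simp add: norm_vec_def)
  qed
  moreover have "closed (torus :: (complex ^ 'k) set)"
    unfolding torus_def by (intro closed_Collect_all closed_Collect_eq continuous_intros)
  ultimately show ?thesis by (simp add: compact_eq_bounded_closed)
qed

lemma set_integrable_unit_box_continuous:
  fixes f :: "real ^ 'k \<Rightarrow> 'b :: euclidean_space"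
  assumes "continuous_on UNIV f"
  shows "set_integrable lborel unit_box f"
proof (rule set_integrable_subset)
  show "set_integrable lborel (cbox 0 (\<chi> i. 1)) f"
    unfolding set_integrable_def
    by (intro borel_integrable_compact continuous_on_subset[OF assms]) auto
qed (auto simp: box_subset_cbox)


lemma integrable_indicator_unit_box:
  "integrable lborel (indicat_real (unit_box :: (real ^ 'k) set))"
  by (simp add: emeasure_lborel_box_eq integrable_indicator_iff one_inner_Basis)

lemma set_integral_unit_box_const: "(LINT y:(unit_box :: (real ^ 'k) set)|lborel. c) = (c :: 'b :: euclidean_space)"
  using integral_scaleR_left[OF integrable_indicator_unit_box, of c]
  by (simp add: set_lebesgue_integral_def measure_unit_box)

locale weyl_sequence =
  fixes x :: "nat \<Rightarrow> real ^ 'k"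
  assumes weyl: "\<And>w. (\<And>i. w $ i \<in> \<int>) \<Longrightarrow> w \<noteq> 0 \<Longrightarrow>
    (\<lambda>N. (\<Sum>n\<in>{1..N}. cis (2 * pi * (w \<bullet> x n))) / of_nat N) \<longlonglongrightarrow> 0"
begin

lemma trig_poly_average:
  "trig_poly G \<Longrightarrow> (\<lambda>N. (\<Sum>n\<in>{1..N}. G (x n)) / of_nat N) \<longlonglongrightarrow> (LINT y:unit_box|lborel. G y)"
proof (induction rule: trig_poly.induct)
  case (trig_poly_mono w c)
  show ?case
  proof (cases "w = 0")
    case True
    \<comment> \<open>Only eventually, since at \<open>N = 0\<close> division by zero makes the
      quotient \<open>0\<close>.\<close>
    have "\<forall>\<^sub>F N in sequentially. c = (\<Sum>n\<in>{1..N}. c) / of_nat N"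
      using eventually_gt_at_top[of 0] by eventually_elim simp
    then have "(\<lambda>N. (\<Sum>n\<in>{1..N}. c) / of_nat N) \<longlonglongrightarrow> c"
      by (rule Lim_transform_eventually[OF tendsto_const])
    then show ?thesis using True by (simp add: set_integral_unit_box_const)
  next
    case False
    have "(\<lambda>N. c * ((\<Sum>n\<in>{1..N}. cis (2 * pi * (w \<bullet> x n))) / of_nat N)) \<longlonglongrightarrow> c * 0"
      by (intro tendsto_intros weyl False trig_poly_mono)
    then show ?thesis
      using set_integral_unit_box_cis[OF trig_poly_mono False] by (simp add: sum_distrib_left)
  qed
next
  case (trig_poly_add f g)
  have "(LINT y:unit_box|lborel. f y + g y) = (LINT y:unit_box|lborel. f y) + (LINT y:unit_box|lborel. g y)"
    by (intro set_integral_add set_integrable_unit_box_continuous continuous_on_trig_poly trig_poly_add)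
  then show ?case
    using tendsto_add[OF trig_poly_add(3,4)] by (simp add: sum.distrib add_divide_distrib)
qed

lemma continuous_average:
  fixes f :: "complex ^ 'k \<Rightarrow> real"
  assumes f: "continuous_on torus f"
  shows "(\<lambda>N. (\<Sum>n\<in>{1..N}. f (torus_emb (x n))) / real N) \<longlonglongrightarrow> (LINT y:unit_box|lborel. f (torus_emb y))"
proof (rule LIMSEQ_I)
  fix e :: real assume e: "e > 0"
  \<comment> \<open>Three errors of at most \<open>e / 4\<close> will arise: \<open>f\<close>
    against \<open>g\<close> in the average, the average of \<open>g\<close> against its integral,
    and \<open>g\<close> against \<open>f\<close> in the integral.\<close>
  obtain g where g: "real_polynomial_function g" "\<And>z. z \<in> torus \<Longrightarrow> \<bar>f z - g z\<bar> < e / 4"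
    using Stone_Weierstrass_real_polynomial_function[OF compact_torus f, of "e / 4"] e by auto
  let ?F = "LINT y:unit_box|lborel. f (torus_emb y)"
  let ?G = "LINT y:unit_box|lborel. g (torus_emb y)"
  have "(\<lambda>N. (\<Sum>n\<in>{1..N}. complex_of_real (g (torus_emb (x n)))) / of_nat N) \<longlonglongrightarrow> of_real ?G"
    using trig_poly_average[OF trig_poly_real_polynomial_function[OF g(1)]]
    by (simp only: set_integral_complex_of_real)
  then have "(\<lambda>N. complex_of_real ((\<Sum>n\<in>{1..N}. g (torus_emb (x n))) / real N)) \<longlonglongrightarrow> of_real ?G"
    by simp
  then have "(\<lambda>N. (\<Sum>n\<in>{1..N}. g (torus_emb (x n))) / real N) \<longlonglongrightarrow> ?G"
    by (simp only: tendsto_of_real_iff)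
  then obtain N0 where N0: "\<And>N. N \<ge> N0 \<Longrightarrow> \<bar>(\<Sum>n\<in>{1..N}. g (torus_emb (x n))) / real N - ?G\<bar> < e / 4"
    using LIMSEQ_D[of "\<lambda>N. (\<Sum>n\<in>{1..N}. g (torus_emb (x n))) / real N" ?G "e / 4"] e by auto
  have d: "\<bar>f (torus_emb y) - g (torus_emb y)\<bar> < e / 4" for y
    using g(2) torus_emb_in_torus by blast
  have contf: "continuous_on UNIV (\<lambda>y. f (torus_emb y))"
    by (rule continuous_on_compose2[OF f continuous_torus_emb]) (auto simp: torus_emb_in_torus)
  have contg: "continuous_on UNIV (\<lambda>y. g (torus_emb y))"
    using g(1) by (intro continuous_on_compose2[OF _ continuous_torus_emb, of UNIV g])
       (auto intro: continuous_on_polymonial_function simp: real_polynomial_function_eq)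
  have I: "?F \<le> ?G + e / 4" "?G \<le> ?F + e / 4"
  proof -
    have "?F \<le> (LINT y:unit_box|lborel. g (torus_emb y) + e / 4)"
    proof (rule set_integral_mono)
      fix y show "f (torus_emb y) \<le> g (torus_emb y) + e / 4" using d[of y] by linarith
    qed (intro set_integrable_unit_box_continuous continuous_intros contf contg)+
    also have "\<dots> = ?G + e / 4"
      by (subst set_integral_add) (auto intro!: set_integrable_unit_box_continuous contg simp: set_integral_unit_box_const)
    finally show "?F \<le> ?G + e / 4" .
    have "?G \<le> (LINT y:unit_box|lborel. f (torus_emb y) + e / 4)"
    proof (rule set_integral_mono)
      fix y show "g (torus_emb y) \<le> f (torus_emb y) + e / 4" using d[of y] by linarith
    qed (intro set_integrable_unit_box_continuous continuous_intros contf contg)+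
    also have "\<dots> = ?F + e / 4"
      by (subst set_integral_add) (auto intro!: set_integrable_unit_box_continuous contf simp: set_integral_unit_box_const)
    finally show "?G \<le> ?F + e / 4" .
  qed
  have "norm ((\<Sum>n\<in>{1..N}. f (torus_emb (x n))) / real N - ?F) < e" if N: "N \<ge> max 1 N0" for N
  proof -
    have "\<bar>(\<Sum>n\<in>{1..N}. f (torus_emb (x n))) - (\<Sum>n\<in>{1..N}. g (torus_emb (x n)))\<bar>
        \<le> (\<Sum>n\<in>{1..N}. \<bar>f (torus_emb (x n)) - g (torus_emb (x n))\<bar>)"
      unfolding sum_subtractf[symmetric] by (rule sum_abs)
    also have "\<dots> \<le> (\<Sum>n\<in>{1..N}. e / 4)" by (intro sum_mono less_imp_le d)
    finally have "\<bar>(\<Sum>n\<in>{1..N}. f (torus_emb (x n))) - (\<Sum>n\<in>{1..N}. g (torus_emb (x n)))\<bar> / real N \<le> e / 4"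
      using N by (simp add: pos_divide_le_eq mult.commute)
    then have "\<bar>(\<Sum>n\<in>{1..N}. f (torus_emb (x n))) / real N - (\<Sum>n\<in>{1..N}. g (torus_emb (x n))) / real N\<bar> \<le> e / 4"
      by (simp add: abs_divide flip: diff_divide_distrib)
    moreover have "\<bar>(\<Sum>n\<in>{1..N}. g (torus_emb (x n))) / real N - ?G\<bar> < e / 4"
      by (rule N0) (use N in simp)
    ultimately show ?thesis using I e unfolding real_norm_def by linarith
  qed
  then show "\<exists>no. \<forall>N\<ge>no. norm ((\<Sum>n\<in>{1..N}. f (torus_emb (x n))) / real N - ?F) < e" by blast
qed

text \<open>The indicator of a closed set is the decreasing limit of continuous functions. Dominated
  convergence picks one whose integral is close to the measure, and the average of that function
  bounds the density.\<close>

lemma closed_upper_density: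
  assumes K: "closed K" and e: "e > 0"
  shows "\<forall>\<^sub>F N in sequentially. real (card {n \<in> {1..N}. torus_emb (x n) \<in> K}) / real N
           \<le> measure lborel {y \<in> unit_box. torus_emb y \<in> K} + e"
\<comment> \<open>By convention \<open>infdist\<close> to the empty set is \<open>0\<close>, so the
  functions \<open>F j\<close> below would all be \<open>1\<close> there.\<close>
proof (cases "K = {}")
  case True then show ?thesis using e by simp
next
  case False
  define F where "F j z = max 0 (1 - real j * infdist z K)" for j :: nat and z
  have contF: "continuous_on S (F j)" for j S
    unfolding F_def by (intro continuous_intros)
  have F_bd: "0 \<le> F j z" "F j z \<le> 1" for j z
    by (auto simp: F_def infdist_nonneg)
  have Km: "{y \<in> unit_box. torus_emb y \<in> K} \<in> sets lborel"
  proof -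
    have "closed (torus_emb -` K)"
      using continuous_closed_vimage[OF K] continuous_torus_emb[of UNIV] by (auto simp: continuous_on_eq_continuous_at)
    moreover have "{y \<in> unit_box. torus_emb y \<in> K} = unit_box \<inter> torus_emb -` K" by auto
    ultimately show ?thesis by simp
  qed
  have "(\<lambda>j. LINT y:unit_box|lborel. F j (torus_emb y))
      \<longlonglongrightarrow> (\<integral>y. indicator {y \<in> unit_box. torus_emb y \<in> K} y \<partial>lborel)"
    unfolding set_lebesgue_integral_def
  proof (rule integral_dominated_convergence[where w = "indicat_real unit_box"])
    show "integrable lborel (indicat_real (unit_box :: (real ^ 'k) set))"
      by (rule integrable_indicator_unit_box)
    show "(\<lambda>y. indicat_real unit_box y *\<^sub>R F j (torus_emb y)) \<in> borel_measurable lborel" for j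
      using borel_measurable_continuous_onI[OF continuous_on_compose2[OF contF continuous_torus_emb subset_UNIV]]
      by (intro borel_measurable_scaleR borel_measurable_indicator) auto
    show "indicat_real {y \<in> unit_box. torus_emb y \<in> K} \<in> borel_measurable lborel"
      using Km by simp
    show "AE y in lborel. norm (indicat_real unit_box y *\<^sub>R F j (torus_emb y)) \<le> indicat_real unit_box y" for j
      using F_bd by (auto simp: indicator_def)
    show "AE y in lborel. (\<lambda>j. indicat_real unit_box y *\<^sub>R F j (torus_emb y))
        \<longlonglongrightarrow> indicat_real {y \<in> unit_box. torus_emb y \<in> K} y"
    proof (intro AE_I2)
      fix y :: "real ^ 'k"
      have "(\<lambda>j. F j (torus_emb y)) \<longlonglongrightarrow> indicat_real K (torus_emb y)"
      proof (cases "torus_emb y \<in> K")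
        case True then show ?thesis by (simp add: F_def)
      next
        case out: False
        then have pos: "infdist (torus_emb y) K > 0" by (rule infdist_pos_not_in_closed[OF K False])
        have "\<forall>\<^sub>F j in sequentially. real j \<ge> 1 / infdist (torus_emb y) K"
          using filterlim_real_sequentially unfolding filterlim_at_top by blast
        then have "\<forall>\<^sub>F j in sequentially. 0 = F j (torus_emb y)"
          by eventually_elim (use pos in \<open>simp add: F_def field_simps max_def\<close>)
        then show ?thesis using out by (simp add: Lim_transform_eventually[OF tendsto_const])
      qed
      then show "(\<lambda>j. indicat_real unit_box y *\<^sub>R F j (torus_emb y))
        \<longlonglongrightarrow> indicat_real {y \<in> unit_box. torus_emb y \<in> K} y"
        by (auto simp: indicator_def)
    qed
  qed
  then have "(\<lambda>j. LINT y:unit_box|lborel. F j (torus_emb y)) \<longlonglongrightarrow> measure lborel {y \<in> unit_box. torus_emb y \<in> K}"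
    by simp
  then have "\<forall>\<^sub>F j in sequentially. (LINT y:unit_box|lborel. F j (torus_emb y)) < measure lborel {y \<in> unit_box. torus_emb y \<in> K} + e / 2"
    using e by (intro order_tendstoD(2)) auto
  then obtain j where j: "(LINT y:unit_box|lborel. F j (torus_emb y)) < measure lborel {y \<in> unit_box. torus_emb y \<in> K} + e / 2"
    using eventually_happens by force
  have "\<forall>\<^sub>F N in sequentially. (\<Sum>n\<in>{1..N}. F j (torus_emb (x n))) / real N < (LINT y:unit_box|lborel. F j (torus_emb y)) + e / 2"
    using e by (intro order_tendstoD(2)[OF continuous_average[OF contF]]) auto
  then show ?thesis
  proof eventually_elim
    case (elim N)
    have "real (card {n \<in> {1..N}. torus_emb (x n) \<in> K}) = (\<Sum>n\<in>{n \<in> {1..N}. torus_emb (x n) \<in> K}. F j (torus_emb (x n)))"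
      by (simp add: F_def)
    also have "\<dots> \<le> (\<Sum>n\<in>{1..N}. F j (torus_emb (x n)))"
      by (intro sum_mono2) (auto simp: F_bd)
    finally have "real (card {n \<in> {1..N}. torus_emb (x n) \<in> K}) / real N \<le> (\<Sum>n\<in>{1..N}. F j (torus_emb (x n))) / real N"
      by (intro divide_right_mono) auto
    then show ?case using elim j by linarith
  qed
qed

end

section \<open>From closed subsets of the torus to boxes\<close>

lemma torus_emb_frac: "torus_emb (\<chi> i. frac (y $ i)) = torus_emb y"
proof -
  have "cis (2 * pi * frac t) = cis (2 * pi * t)" for t
  proof -
    have "2 * pi * t = 2 * pi * frac t + 2 * pi * of_int \<lfloor>t\<rfloor>"
      by (simp add: frac_def algebra_simps)
    then have "cis (2 * pi * t) = cis (2 * pi * frac t) * cis (2 * pi * of_int \<lfloor>t\<rfloor>)"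
      by (simp only: cis_mult)
    moreover have "cis (2 * pi * of_int \<lfloor>t\<rfloor>) = 1" by (rule cis_multiple_2pi) simp
    ultimately show ?thesis by simp
  qed
  then show ?thesis by (simp add: torus_emb_def)
qed

text \<open>Equal images differ by an integer in each coordinate. With one point in the open cube
  and the other in the closed cube, the difference lies strictly between \<open>-1\<close> and
  \<open>1\<close>, so no wrap-around occurs.\<close>

lemma torus_emb_inj:
  assumes y: "y \<in> unit_box" and y': "y' \<in> cbox 0 (\<chi> i. 1)" and eq: "torus_emb y = torus_emb y'"
  shows "y = y'"
proof -
  have "y $ i = y' $ i" for i
  proof -
    have "cis (2 * pi * y $ i) = cis (2 * pi * y' $ i)"
      using eq by (simp add: torus_emb_def vec_eq_iff)
    then have "cis (2 * pi * y $ i - 2 * pi * y' $ i) = 1"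
      by (simp flip: cis_divide)
    then have "cos (2 * pi * y $ i - 2 * pi * y' $ i) = 1"
      by (simp add: complex_eq_iff)
    then obtain n :: int where "2 * pi * y $ i - 2 * pi * y' $ i = of_int n * 2 * pi"
      by (auto simp: cos_one_2pi_int)
    then have "2 * pi * (y $ i - y' $ i) = 2 * pi * of_int n" by (simp add: algebra_simps)
    then have n: "y $ i - y' $ i = of_int n" by simp
    have "0 < y $ i" "y $ i < 1" "0 \<le> y' $ i" "y' $ i \<le> 1"
      using y y' by (auto simp: mem_box_cart)
    then have "-1 < real_of_int n" "real_of_int n < 1" using n by linarith+
    then have "n = 0" by linarith
    then show ?thesis using n by simp
  qed
  then show ?thesis by (simp add: vec_eq_iff)
qed

lemma torus_preimage_image:
  assumes "C \<subseteq> cbox 0 (\<chi> i. 1)"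
  shows "{y \<in> unit_box. torus_emb y \<in> torus_emb ` C} = unit_box \<inter> C"
  using assms torus_emb_inj by blast

text \<open>Both the closure of the box and the complement of its interior in the closed unit cube
  satisfy the upper bound for closed sets, and their measures add up to \<open>1\<close>.\<close>

lemma (in weyl_sequence) unif_dist_mod1: "unif_dist_mod1 x"
  unfolding unif_dist_mod1_def
proof (intro allI impI)
  fix I :: "'k \<Rightarrow> real set"
  assume I: "\<forall>i. is_interval (I i) \<and> I i \<subseteq> {0..1}"
  define A where "A = {y :: real ^ 'k. \<forall>i. y $ i \<in> I i}"
  define U where "U = cbox (0 :: real ^ 'k) (\<chi> i. 1)"
  have "0 \<le> y $ i \<and> y $ i \<le> 1" if "y \<in> A" for y i
    using I that unfolding A_def by (metis atLeastAtMost_iff mem_Collect_eq subset_iff)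
  then have AU: "A \<subseteq> U" by (auto simp: U_def mem_box_cart)
  \<comment> \<open>Convexity treats intervals of every kind at once: the frontier of a convex set
    is negligible, so \<open>A\<close>, its closure and its interior have the same measure.\<close>
  have "convex A"
  proof -
    have "convex ((\<lambda>y :: real ^ 'k. y $ i) -` I i)" for i
      using I by (intro convex_linear_vimage bounded_linear.linear[OF bounded_linear_vec_nth]) (simp add: is_interval_convex)
    then have "convex (\<Inter>i. (\<lambda>y :: real ^ 'k. y $ i) -` I i)" by (intro convex_INT)
    moreover have "A = (\<Inter>i. (\<lambda>y :: real ^ 'k. y $ i) -` I i)" by (auto simp: A_def)
    ultimately show ?thesis by simp
  qed
  have bA: "bounded A" by (rule bounded_subset[OF _ AU]) (simp add: U_def)
  have neg: "negligible (frontier A)" by (rule negligible_convex_frontier[OF \<open>convex A\<close>])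
  have lA: "A \<in> lmeasurable" by (rule measurable_convex[OF \<open>convex A\<close> bA])
  have mcl: "measure lebesgue (closure A) = measure lebesgue A"
    by (rule measure_closure[OF bA neg])
  have mint: "measure lebesgue (interior A) = measure lebesgue A"
    by (rule measure_interior[OF bA neg])
  define \<mu> where "\<mu> = measure lebesgue A"
  define q where "q N = real (card {n \<in> {1..N}. (\<chi> i. frac (x n $ i)) \<in> A}) / real N" for N
  have clU: "closure A \<subseteq> U" unfolding U_def by (rule closure_minimal[OF AU[unfolded U_def] closed_cbox])
  have intA: "interior A \<subseteq> unit_box"
    using interior_mono[OF AU] by (simp add: U_def interior_cbox)
  have cont: "closed (torus_emb ` C)" if "compact C" for C :: "(real ^ 'k) set"
    by (intro compact_imp_closed compact_continuous_image continuous_torus_emb that)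
  have fr: "torus_emb (x n) \<in> torus_emb ` C" if "(\<chi> i. frac (x n $ i)) \<in> C" for n C
    using that torus_emb_frac[of "x n"] by (metis imageI)
  have "q \<longlonglongrightarrow> \<mu>"
  proof (rule LIMSEQ_I)
    fix e :: real assume e: "e > 0"
    have m1: "measure lborel {y \<in> unit_box. torus_emb y \<in> torus_emb ` closure A} \<le> \<mu>"
    proof -
      have "measure lborel {y \<in> unit_box. torus_emb y \<in> torus_emb ` closure A} = measure lebesgue (unit_box \<inter> closure A)"
        using torus_preimage_image[OF clU[unfolded U_def]] by (simp add: measure_completion)
      also have "\<dots> \<le> measure lebesgue (closure A)"
        using bA by (intro measure_mono_fmeasurable) (auto intro!: lmeasurable_compact simp: compact_closure)
      finally show ?thesis by (simp add: \<mu>_def mcl)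
    qed
    have m2: "measure lborel {y \<in> unit_box. torus_emb y \<in> torus_emb ` (U - interior A)} = 1 - \<mu>"
    proof -
      have "{y \<in> unit_box. torus_emb y \<in> torus_emb ` (U - interior A)} = unit_box \<inter> (U - interior A)"
        by (rule torus_preimage_image) (auto simp: U_def)
      also have "\<dots> = unit_box - interior A" by (auto simp: U_def intro: subsetD[OF box_subset_cbox])
      finally have "measure lborel {y \<in> unit_box. torus_emb y \<in> torus_emb ` (U - interior A)}
         = measure lborel (unit_box - interior A)" by simp
      also have "\<dots> = measure lborel (unit_box :: (real ^ 'k) set) - measure lborel (interior A)"
        using intA by (intro measure_Diff) (auto simp: emeasure_lborel_box_eq)
      also have "measure lborel (interior A) = \<mu>"
        using mint by (simp add: \<mu>_def measure_completion)
      finally show ?thesis by (simp add: measure_unit_box)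
    qed
    have "\<forall>\<^sub>F N in sequentially. real (card {n \<in> {1..N}. torus_emb (x n) \<in> torus_emb ` closure A}) / real N \<le> \<mu> + e / 2"
      using closed_upper_density[OF cont[of "closure A"], of "e / 2"] e bA m1
      by (auto simp: compact_closure elim!: eventually_mono)
    moreover have "\<forall>\<^sub>F N in sequentially. real (card {n \<in> {1..N}. torus_emb (x n) \<in> torus_emb ` (U - interior A)}) / real N \<le> 1 - \<mu> + e / 2"
    proof -
      have "compact (U - interior A)" by (simp add: U_def compact_diff)
      from closed_upper_density[OF cont[OF this], of "e / 2"] show ?thesis
        using e by (simp only: m2)
    qed
    moreover have "\<forall>\<^sub>F N::nat in sequentially. N > 0" by (rule eventually_gt_at_top)
    ultimately have "\<forall>\<^sub>F N in sequentially. norm (q N - \<mu>) < e"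
    proof eventually_elim
      case (elim N)
      have "card {n \<in> {1..N}. (\<chi> i. frac (x n $ i)) \<in> A} \<le> card {n \<in> {1..N}. torus_emb (x n) \<in> torus_emb ` closure A}"
        by (intro card_mono) (auto intro!: fr intro: subsetD[OF closure_subset])
      then have "q N \<le> real (card {n \<in> {1..N}. torus_emb (x n) \<in> torus_emb ` closure A}) / real N"
        unfolding q_def by (intro divide_right_mono) auto
      then have up: "q N \<le> \<mu> + e / 2" using elim(1) by linarith
      \<comment> \<open>Every vector of fractional parts lies in the closed cube, hence in
        \<open>A\<close> or in \<open>U - interior A\<close>. The upper bound for the latter thereby
        becomes a lower bound for \<open>q N\<close>.\<close>
      have "{1..N} \<subseteq> {n \<in> {1..N}. (\<chi> i. frac (x n $ i)) \<in> A}
          \<union> {n \<in> {1..N}. torus_emb (x n) \<in> torus_emb ` (U - interior A)}"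
      proof
        fix n assume n: "n \<in> {1..N}"
        have "(\<chi> i. frac (x n $ i)) \<in> U"
          by (auto simp: U_def mem_box_cart frac_lt_1 less_imp_le)
        then have "(\<chi> i. frac (x n $ i)) \<in> A \<or> (\<chi> i. frac (x n $ i)) \<in> U - interior A"
          using interior_subset[of A] by blast
        then show "n \<in> {n \<in> {1..N}. (\<chi> i. frac (x n $ i)) \<in> A}
          \<union> {n \<in> {1..N}. torus_emb (x n) \<in> torus_emb ` (U - interior A)}" using n fr by blast
      qed
      then have "card {1..N} \<le> card ({n \<in> {1..N}. (\<chi> i. frac (x n $ i)) \<in> A}
          \<union> {n \<in> {1..N}. torus_emb (x n) \<in> torus_emb ` (U - interior A)})"
        by (intro card_mono) auto
      also have "\<dots> \<le> card {n \<in> {1..N}. (\<chi> i. frac (x n $ i)) \<in> A}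
          + card {n \<in> {1..N}. torus_emb (x n) \<in> torus_emb ` (U - interior A)}"
        by (rule card_Un_le)
      finally have "real N \<le> real (card {n \<in> {1..N}. (\<chi> i. frac (x n $ i)) \<in> A})
          + real (card {n \<in> {1..N}. torus_emb (x n) \<in> torus_emb ` (U - interior A)})" by simp
      then have "1 \<le> q N + real (card {n \<in> {1..N}. torus_emb (x n) \<in> torus_emb ` (U - interior A)}) / real N"
        using elim(3) by (simp add: q_def field_simps)
      then show ?case using up elim(2) e unfolding real_norm_def by linarith
    qed
    then show "\<exists>no. \<forall>N\<ge>no. norm (q N - \<mu>) < e" by (simp add: eventually_sequentially)
  qed
  then show "(\<lambda>N. real (card {n \<in> {1..N}. (\<chi> i. frac (x n $ i)) \<in> {y. \<forall>i. y $ i \<in> I i}}) / real N)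
          \<longlonglongrightarrow> measure lebesgue {y :: real ^ 'k. \<forall>i. y $ i \<in> I i}"
    by (simp only: q_def[abs_def] \<mu>_def A_def)
qed

section \<open>Converse: doubling sequences confined to a subgroup of the torus\<close>

lemma scattered_power2:
  assumes c: "c \<noteq> 0"
  shows "scattered (\<lambda>n. c * 2 ^ n)"
  unfolding scattered_def delta_scattered_def
proof (intro allI impI exI[of _ 1] conjI)
  fix \<delta> :: real assume \<delta>: "0 < \<delta> \<and> \<delta> \<le> 1"
  define q where "q = (2::real) powr - \<delta>"
  have q: "0 < q" "q < 1" using \<delta> by (auto simp: q_def powr_less_one)
  \<comment> \<open>For \<open>m < n\<close> the difference of the powers is at least
    \<open>2 ^ m\<close>, so the terms decay geometrically in \<open>m\<close>. Summing the series
    for each of at most \<open>N\<close> values of \<open>n\<close> gives \<open>N * K\<close>, and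
    the mean is at most \<open>K / N\<close>, below the logarithmic bound for large
    \<open>N\<close>.\<close>
  define K where "K = \<bar>c\<bar> powr - \<delta> / (1 - q)"
  have K: "K > 0" using q c by (simp add: K_def)
  let ?t = "\<lambda>m n. if c * 2 ^ n = c * 2 ^ m then 1 else min (\<bar>c * 2 ^ n - c * 2 ^ m\<bar> powr (- \<delta>)) 1"
  have bd: "?t m n \<le> \<bar>c\<bar> powr - \<delta> * q ^ m" if "m < n" for m n :: nat
  proof -
    have "(2::real) ^ Suc m \<le> 2 ^ n" using that by (intro power_increasing) auto
    then have le: "(2::real) ^ m \<le> 2 ^ n - 2 ^ m" by simp
    have "\<bar>c\<bar> * 2 ^ m \<le> \<bar>c\<bar> * (2 ^ n - 2 ^ m)" by (intro mult_left_mono le) auto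
    also have "\<dots> = \<bar>c * (2 ^ n - 2 ^ m)\<bar>"
    proof -
      have "0 < (2::real) ^ m" by simp
      then have "\<bar>(2::real) ^ n - 2 ^ m\<bar> = 2 ^ n - 2 ^ m" using le by linarith
      then show ?thesis by (simp only: abs_mult)
    qed
    finally have "\<bar>c\<bar> * 2 ^ m \<le> \<bar>c * 2 ^ n - c * 2 ^ m\<bar>" by (simp add: algebra_simps)
    then have "\<bar>c * 2 ^ n - c * 2 ^ m\<bar> powr - \<delta> \<le> (\<bar>c\<bar> * 2 ^ m) powr - \<delta>"
      using c \<delta> by (intro powr_mono2') auto
    also have "\<dots> = \<bar>c\<bar> powr - \<delta> * q ^ m"
      by (simp add: powr_mult q_def powr_power flip: powr_realpow) (simp add: powr_powr mult.commute)
    finally show ?thesis using that c by auto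
  qed
  have "\<forall>\<^sub>F N in sequentially. K / real N \<le> 1 / ln (real N) powr (1 + 1)"
    using K by real_asymp
  then show "\<forall>\<^sub>F N in sequentially. 1 / (real N)\<^sup>2 *
      (\<Sum>(m, n) \<in> {(m, n). 1 \<le> m \<and> m < n \<and> n \<le> N}. ?t m n) \<le> 1 / ln (real N) powr (1 + 1)"
    using eventually_gt_at_top[of 0]
  proof eventually_elim
    case (elim N)
    have "(\<Sum>(m, n) \<in> {(m, n). 1 \<le> m \<and> m < n \<and> n \<le> N}. ?t m n)
        \<le> (\<Sum>(m, n) \<in> {(m, n). 1 \<le> m \<and> m < n \<and> n \<le> N}. \<bar>c\<bar> powr - \<delta> * q ^ m)"
      using bd by (intro sum_mono) auto
    also have "\<dots> \<le> (\<Sum>(m, n) \<in> {..<Suc N} \<times> {1..N}. \<bar>c\<bar> powr - \<delta> * q ^ m)"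
      by (intro sum_mono2) (use q in auto)
    also have "\<dots> = (\<Sum>m<Suc N. \<Sum>n\<in>{1..N}. \<bar>c\<bar> powr - \<delta> * q ^ m)"
      by (simp only: sum.cartesian_product)
    also have "\<dots> = real N * \<bar>c\<bar> powr - \<delta> * (\<Sum>m<Suc N. q ^ m)"
      by (simp only: sum_constant card_atLeastAtMost sum_distrib_left mult.assoc) simp
    also have "\<dots> \<le> real N * \<bar>c\<bar> powr - \<delta> * (1 / (1 - q))"
    proof (rule mult_left_mono)
      have "(\<Sum>m<Suc N. q ^ m) \<le> (\<Sum>m. q ^ m)"
        using q by (intro sum_le_suminf summable_geometric) auto
      also have "\<dots> = 1 / (1 - q)" using q by (intro suminf_geometric) auto
      finally show "(\<Sum>m<Suc N. q ^ m) \<le> 1 / (1 - q)" .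
    qed simp
    also have "\<dots> = real N * K" by (simp add: K_def)
    finally have "1 / (real N)\<^sup>2 * (\<Sum>(m, n) \<in> {(m, n). 1 \<le> m \<and> m < n \<and> n \<le> N}. ?t m n)
        \<le> 1 / (real N)\<^sup>2 * (real N * K)"
      by (intro mult_left_mono) auto
    also have "\<dots> = K / real N" using elim by (simp add: power2_eq_square)
    finally show ?case using elim(1) by linarith
  qed
qed simp

text \<open>The fractional parts over \<open>S\<close> also have an integer sum, so a box on which
  that sum stays strictly between \<open>0\<close> and \<open>1\<close> is never visited, although
  its volume is positive.\<close>

lemma not_unif_dist_mod1_of_integer_sum:
  fixes x :: "nat \<Rightarrow> real ^ 'k"
  assumes S: "S \<noteq> {}" and int: "\<And>n. (\<Sum>i\<in>S. x n $ i) \<in> \<int>"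
  shows "\<not> unif_dist_mod1 x"
proof
  assume ud: "unif_dist_mod1 x"
  define s where "s = real (card S)"
  have s: "s \<ge> 1" using S by (simp add: s_def Suc_le_eq card_gt_0_iff)
  \<comment> \<open>Summed over the \<open>s\<close> indices in \<open>S\<close>, these bounds
    confine the sum to \<open>1/4\<close> through \<open>1/2\<close>; the other coordinates range
    over all of \<open>{0..1}\<close>.\<close>
  define l where "l = (\<chi> i. if i \<in> S then 1 / (4 * s) else 0)"
  define u where "u = (\<chi> i. if i \<in> S then 1 / (2 * s) else 1)"
  define I where "I i = {l $ i..u $ i}" for i
  have "1 / (2 * s) \<le> 1" using s by simp
  then have I: "\<forall>i. is_interval (I i) \<and> I i \<subseteq> {0..1}"
    using s by (auto simp: I_def l_def u_def is_interval_cc intro: order_trans)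
  have box: "{y. \<forall>i. y $ i \<in> I i} = cbox l u" by (auto simp: I_def mem_box_cart)
  have out: "(\<chi> i. frac (x n $ i)) \<notin> cbox l u" for n
  proof
    assume "(\<chi> i. frac (x n $ i)) \<in> cbox l u"
    then have f: "1 / (4 * s) \<le> frac (x n $ i)" "frac (x n $ i) \<le> 1 / (2 * s)" if "i \<in> S" for i
      using that by (auto simp: mem_box_cart l_def u_def split: if_splits)
    have "(\<Sum>i\<in>S. 1 / (4 * s)) \<le> (\<Sum>i\<in>S. frac (x n $ i))" "(\<Sum>i\<in>S. frac (x n $ i)) \<le> (\<Sum>i\<in>S. 1 / (2 * s))"
      by (intro sum_mono f; assumption)+
    then have b: "1 / 4 \<le> (\<Sum>i\<in>S. frac (x n $ i))" "(\<Sum>i\<in>S. frac (x n $ i)) \<le> 1 / 2"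
      using s by (simp_all flip: s_def)
    have "(\<Sum>i\<in>S. frac (x n $ i)) = (\<Sum>i\<in>S. x n $ i) - (\<Sum>i\<in>S. of_int \<lfloor>x n $ i\<rfloor>)"
      by (simp add: frac_def sum_subtractf)
    then have "(\<Sum>i\<in>S. frac (x n $ i)) \<in> \<int>" using int[of n] by (auto intro!: Ints_diff Ints_sum)
    then obtain m :: int where "(\<Sum>i\<in>S. frac (x n $ i)) = of_int m" by (auto elim: Ints_cases)
    then have "0 < real_of_int m" "real_of_int m < 1" using b by linarith+
    then have "0 < m" "m < 1" by simp_all
    then show False by linarith
  qed
  have "(\<lambda>N. real (card {n \<in> {1..N}. (\<chi> i. frac (x n $ i)) \<in> {y. \<forall>i. y $ i \<in> I i}}) / real N)
          \<longlonglongrightarrow> measure lebesgue {y :: real ^ 'k. \<forall>i. y $ i \<in> I i}"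
    using ud I unfolding unif_dist_mod1_def by blast
  then have "(\<lambda>N. 0 :: real) \<longlonglongrightarrow> measure lebesgue (cbox l u)"
    unfolding box by (simp add: out)
  then have "measure lebesgue (cbox l u) = 0" by (simp add: LIMSEQ_const_iff)
  moreover have "measure lborel (cbox l u) > 0"
    unfolding content_pos_lt_eq using s by (auto simp: Basis_vec_def inner_axis l_def u_def frac_less2)
  ultimately show False by (simp add: measure_completion)
qed

theorem theorem1p5:
  fixes p :: "'k::finite \<Rightarrow> real poly"
  shows "lin_indep_with_one p \<longleftrightarrow>
    (\<forall>a :: 'k \<Rightarrow> nat \<Rightarrow> real. (\<forall>i. scattered (a i)) \<longrightarrow>
       (AE x in lebesgue. unif_dist_mod1 (\<lambda>n. \<chi> i. a i n * poly (p i) x)))"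
proof (intro iffI allI impI)
  fix a :: "'k \<Rightarrow> nat \<Rightarrow> real"
  assume indep: "lin_indep_with_one p" and scat: "\<forall>i. scattered (a i)"
  have "AE x in lebesgue. \<forall>h :: 'k \<Rightarrow> int. (\<exists>j. h j \<noteq> 0) \<longrightarrow> (\<lambda>N. (\<Sum>n\<in>{1..N}.
      cis (2 * pi * (\<Sum>i\<in>UNIV. of_int (h i) * (a i n * poly (p i) x)))) / of_nat N) \<longlonglongrightarrow> 0"
    \<comment> \<open>There are only countably many integer vectors \<open>h\<close>, so one null
      set serves for all of them.\<close>
    unfolding AE_all_countable
  proof
    fix h :: "'k \<Rightarrow> int"
    show "AE x in lebesgue. (\<exists>j. h j \<noteq> 0) \<longrightarrow> (\<lambda>N. (\<Sum>n\<in>{1..N}.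
      cis (2 * pi * (\<Sum>i\<in>UNIV. of_int (h i) * (a i n * poly (p i) x)))) / of_nat N) \<longlonglongrightarrow> 0"
    proof (cases "\<exists>j. h j \<noteq> 0")
      case True
      then obtain j where "h j \<noteq> 0" by blast
      with AE_exponential_average_tendsto_0[where h = h, OF indep] scat show ?thesis
        by (auto elim!: eventually_mono)
    qed simp
  qed
  then show "AE x in lebesgue. unif_dist_mod1 (\<lambda>n. \<chi> i. a i n * poly (p i) x)"
  proof eventually_elim
    case (elim x)
    interpret weyl_sequence "\<lambda>n. \<chi> i. a i n * poly (p i) x"
    proof
      fix w :: "real ^ 'k" assume w: "\<And>i. w $ i \<in> \<int>" "w \<noteq> 0"
      then have "\<forall>i. \<exists>h. w $ i = of_int h" by (metis Ints_cases)
      then obtain h where h: "\<And>i. w $ i = of_int (h i)" by metis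
      then have "\<exists>j. h j \<noteq> 0" using w(2) by (auto simp: vec_eq_iff)
      with elim have "(\<lambda>N. (\<Sum>n\<in>{1..N}.
        cis (2 * pi * (\<Sum>i\<in>UNIV. of_int (h i) * (a i n * poly (p i) x)))) / of_nat N) \<longlonglongrightarrow> 0" by blast
      then show "(\<lambda>N. (\<Sum>n\<in>{1..N}. cis (2 * pi * (w \<bullet> (\<chi> i. a i n * poly (p i) x)))) / of_nat N) \<longlonglongrightarrow> 0"
        by (simp add: inner_vec_def h)
    qed
    show ?case by (rule unif_dist_mod1)
  qed
next
  assume ud: "\<forall>a :: 'k \<Rightarrow> nat \<Rightarrow> real. (\<forall>i. scattered (a i)) \<longrightarrow>
       (AE x in lebesgue. unif_dist_mod1 (\<lambda>n. \<chi> i. a i n * poly (p i) x))"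
  show "lin_indep_with_one p"
    unfolding lin_indep_with_one_def
  proof (intro allI impI, rule ccontr)
    fix c0 :: real and c :: "'k \<Rightarrow> real"
    assume dep: "smult c0 1 + (\<Sum>i\<in>UNIV. smult (c i) (p i)) = 0" and nz: "\<not> (c0 = 0 \<and> (\<forall>i. c i = 0))"
    define S where "S = {i. c i \<noteq> 0}"
    have "S \<noteq> {}"
    proof
      assume "S = {}"
      then have "\<forall>i. c i = 0" by (auto simp: S_def)
      then show False using dep nz by simp
    qed
    \<comment> \<open>Division by \<open>c0\<close> normalises the constant term to
      \<open>1\<close>, so that the sum over \<open>S\<close> becomes \<open>- (2 ^ n)\<close>; if
      \<open>c0 = 0\<close>, the sum is \<open>0\<close> and no scaling is required.\<close>
    define \<gamma> where "\<gamma> = (if c0 = 0 then 1 else c0)"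
    \<comment> \<open>Where \<open>c i = 0\<close>, the formula
      \<open>c i / \<gamma> * 2 ^ n\<close> would give the zero sequence, which is not scattered.
      The factor \<open>1\<close> replaces it; these coordinates lie outside
      \<open>S\<close>.\<close>
    define a where "a i n = (if c i = 0 then 1 else c i / \<gamma>) * 2 ^ n" for i and n :: nat
    have "scattered (a i)" for i
      unfolding a_def[abs_def] by (rule scattered_power2) (simp add: \<gamma>_def)
    then have "AE x in lebesgue. unif_dist_mod1 (\<lambda>n. \<chi> i. a i n * poly (p i) x)" using ud by blast
    \<comment> \<open>A single point \<open>x\<close> suffices for the contradiction, as the
      dependency holds at every \<open>x\<close>; the line is not a null set, so such a point
      exists.\<close>
    moreover have "ae_filter (lebesgue :: real measure) \<noteq> bot" by (simp add: ae_filter_eq_bot_iff)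
    ultimately obtain x where x: "unif_dist_mod1 (\<lambda>n. \<chi> i. a i n * poly (p i) x)"
      using eventually_happens' by blast
    have "(\<Sum>i\<in>S. (\<chi> i. a i n * poly (p i) x) $ i) \<in> \<int>" for n
    proof -
      have "c0 + (\<Sum>i\<in>UNIV. c i * poly (p i) x) = 0"
        using arg_cong[OF dep, of "\<lambda>q. poly q x"] by (simp add: poly_sum)
      moreover have "(\<Sum>i\<in>UNIV. c i * poly (p i) x) = (\<Sum>i\<in>S. c i * poly (p i) x)"
        by (rule sum.mono_neutral_right) (auto simp: S_def)
      ultimately have e: "(\<Sum>i\<in>S. c i * poly (p i) x) = - c0" by simp
      have "(\<Sum>i\<in>S. (\<chi> i. a i n * poly (p i) x) $ i) = (\<Sum>i\<in>S. 2 ^ n / \<gamma> * (c i * poly (p i) x))"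
        by (rule sum.cong) (auto simp: a_def S_def)
      also have "\<dots> = 2 ^ n * (- c0 / \<gamma>)" by (simp only: e flip: sum_distrib_left) simp
      also have "\<dots> \<in> \<int>" by (simp add: \<gamma>_def)
      finally show ?thesis .
    qed
    then show False using not_unif_dist_mod1_of_integer_sum[OF \<open>S \<noteq> {}\<close>, of "\<lambda>n. \<chi> i. a i n * poly (p i) x"] x by blast
  qed
qed

end
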